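(* Let $n,p,k,i$ be integers with $n\ge0$, $p\ge1$ and $k\ge i\ge1$. Then \begin{align*} \sum_{m_p\geq \dots\geq m_{1}\geq 0} &\frac{q^{m_p^2+\dots +m_1^2} (q;q)_{2n}}{(q;q)_{n-m_p}(q;q)_{m_p - m_{p-1}}\cdots (q;q)_{m_2-m_1}(q;q)_{2m_1}} \sum_{n_1\geq \dots\geq n_{k-1}\geq n_k=0} q^{n_1^2+\dots+n_{k-1}^2 + n_i+\dots +n_{k-1}} \prod_{j=1}^{k-1} {2m_1- 2\sum_{l=1}^{j-1}n_l -n_j - n_{j+1} - \alpha_{ij}\brack n_j - n_{j+1}}_q \\ &= \sum_{r=-\infty}^{\infty} (-1)^r q^{\frac{r( (2k+1)r + 2k-2i +1)}{2}+p \left\lfloor \frac{i-k-(2k+1)r}{2}\right\rfloor^2} {2n\brack n - \left\lfloor \frac{i-k-(2k+1)r}{2}\right\rfloor }_q. \end{align*}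
   Context: $\alpha_{ij}:=\max\{j-i+1,0\}$. $(a;q)_m=\prod_{j=0}^{m-1}(1-aq^j)$ for $m\ge0$ and $1/(q;q)_m:=0$ for $m<0$. The outer sum is over integers $m_p\ge\dots\ge m_1\ge0$ (for $p=1$ the denominator is $(q;q)_{n-m_1}(q;q)_{2m_1}$); the inner sum is over integers $n_1\ge\dots\ge n_{k-1}\ge0$ with $n_k:=0$, and $n_i+\dots+n_{k-1}=0$ if $i=k$. For integers $a,b$, ${a\brack b}_q=\frac{(q;q)_a}{(q;q)_b(q;q)_{a-b}}$ if $0\le b\le a$ and $0$ otherwise. $\lfloor\cdot\rfloor$ is the floor function. *)

theory Defs
  imports Complex_Main "HOL-Library.FuncSet" "HOL-Library.Groups_Big_Fun"
begin

definition qpoch :: "'a::comm_ring_1 \<Rightarrow> 'a \<Rightarrow> nat \<Rightarrow> 'a" where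
  "qpoch a q m = (\<Prod>j<m. 1 - a * q ^ j)"

text \<open>The reciprocal of \<open>(q;q)\<^sub>m\<close>, extended by \<open>0\<close> to negative \<open>m\<close>.\<close>

definition inv_qfact :: "'a::field \<Rightarrow> int \<Rightarrow> 'a" where
  "inv_qfact q m = (if m < 0 then 0 else 1 / qpoch q q (nat m))"

definition qbinom :: "'a::field \<Rightarrow> int \<Rightarrow> int \<Rightarrow> 'a" where
  "qbinom q a b =
     (if 0 \<le> b \<and> b \<le> a
      then qpoch q q (nat a) / (qpoch q q (nat b) * qpoch q q (nat (a - b))) else 0)"

definition alpha :: "nat \<Rightarrow> nat \<Rightarrow> int" where
  "alpha i j = max (int j - int i + 1) 0"

text \<open>Tuples \<open>m\<^sub>p \<ge> \<dots> \<ge> m\<^sub>1 \<ge> 0\<close>, and \<open>n\<^sub>1 \<ge> \<dots> \<ge> n\<^sub>k\<^sub>-\<^sub>1 \<ge> n\<^sub>k = 0\<close>,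
  as extensional functions on the index set. For \<open>k = 1\<close> there is exactly one tuple of the
  second kind.\<close>

definition outer_tuples :: "nat \<Rightarrow> (nat \<Rightarrow> int) set" where
  "outer_tuples p = {m \<in> {1..p} \<rightarrow>\<^sub>E {0..}. \<forall>j\<in>{1..<p}. m j \<le> m (j + 1)}"

definition inner_tuples :: "nat \<Rightarrow> (nat \<Rightarrow> int) set" where
  "inner_tuples k = {\<nu> \<in> {1..k} \<rightarrow>\<^sub>E {0..}. \<nu> k = 0 \<and> (\<forall>j\<in>{1..<k}. \<nu> j \<ge> \<nu> (j + 1))}"

text \<open>All three sums of the identity range over infinite sets but have only finitely many nonzero
  terms. \<open>Sum_any\<close> is the sum over the support, with the junk value \<open>0\<close> if the
  support is infinite; the lemmas below show that this case does not arise.\<close>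

definition sum_supp :: "'b set \<Rightarrow> ('b \<Rightarrow> 'a::comm_monoid_add) \<Rightarrow> 'a" where
  "sum_supp A f = Sum_any (\<lambda>x. if x \<in> A then f x else 0)"

lemma finite_outer_support:
  assumes "p \<ge> 1"
  shows "finite {m \<in> outer_tuples p. inv_qfact q (int n - m p) \<noteq> 0}"
proof (rule finite_subset)
  show "{m \<in> outer_tuples p. inv_qfact q (int n - m p) \<noteq> 0} \<subseteq> {1..p} \<rightarrow>\<^sub>E {0..int n}"
  proof
    fix m assume "m \<in> {m \<in> outer_tuples p. inv_qfact q (int n - m p) \<noteq> 0}"
    then have m: "m \<in> {1..p} \<rightarrow>\<^sub>E {0..}" and mono: "\<And>j. j \<in> {1..<p} \<Longrightarrow> m j \<le> m (j + 1)"
      and le: "m p \<le> int n"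
      by (auto simp: outer_tuples_def inv_qfact_def split: if_splits)
    have "m j \<le> m p" if "j \<in> {1..p}" for j
    proof -
      have "j \<le> p" "1 \<le> j" using that by auto
      then show ?thesis
      proof (induction rule: inc_induct)
        case base
        then show ?case by simp
      next
        case (step l)
        then show ?case using mono[of l] by simp
      qed
    qed
    then show "m \<in> {1..p} \<rightarrow>\<^sub>E {0..int n}"
      using m le by (fastforce simp: PiE_iff)
  qed
qed (auto intro: finite_PiE)

lemma finite_inner_support:
  fixes M :: int
  assumes "k \<ge> 1"
  shows "finite {\<nu> \<in> inner_tuples k. (\<Prod>j=1..<k.
           qbinom q (2 * M - 2 * (\<Sum>l=1..<j. \<nu> l) - \<nu> j - \<nu> (j + 1) - alpha i j)
             (\<nu> j - \<nu> (j + 1))) \<noteq> 0}" (is "finite ?S")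
proof (rule finite_subset)
  show "?S \<subseteq> {1..k} \<rightarrow>\<^sub>E {0..max M 0}"
  proof
    fix \<nu> assume \<nu>S: "\<nu> \<in> ?S"
    then have \<nu>: "\<nu> \<in> {1..k} \<rightarrow>\<^sub>E {0..}" and mono: "\<And>j. j \<in> {1..<k} \<Longrightarrow> \<nu> (j + 1) \<le> \<nu> j"
      and \<nu>k: "\<nu> k = 0"
      by (auto simp: inner_tuples_def)
    have \<nu>1: "\<nu> 1 \<le> max M 0"
    proof (cases "k = 1")
      case True
      then show ?thesis using \<nu>k by simp
    next
      case False
      then have "qbinom q (2 * M - \<nu> 1 - \<nu> 2 - alpha i 1) (\<nu> 1 - \<nu> 2) \<noteq> 0"
        using \<nu>S assms by (force simp: numeral_2_eq_2)
      then have "\<nu> 1 - \<nu> 2 \<le> 2 * M - \<nu> 1 - \<nu> 2 - alpha i 1"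
        by (auto simp: qbinom_def split: if_splits)
      moreover have "alpha i 1 \<ge> 0" by (simp add: alpha_def)
      ultimately show ?thesis by linarith
    qed
    have "\<nu> j \<le> \<nu> 1" if "j \<in> {1..k}" for j
    proof -
      have "1 \<le> j" "j \<le> k" using that by auto
      then show ?thesis
      proof (induction rule: dec_induct)
        case base
        then show ?case by simp
      next
        case (step l)
        then show ?case using mono[of l] by simp
      qed
    qed
    then show "\<nu> \<in> {1..k} \<rightarrow>\<^sub>E {0..max M 0}"
      using \<nu> \<nu>1 by (fastforce simp: PiE_iff)
  qed
qed (auto intro: finite_PiE)

lemma finite_right_support:
  fixes i k n :: nat
  shows "finite {r::int. qbinom q (2 * int n)
           (int n - \<lfloor>real_of_int (int i - int k - (2 * int k + 1) * r) / 2\<rfloor>) \<noteq> 0}"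
    (is "finite ?S")
proof (rule finite_subset)
  define B where "B = 2 * int n + 2 + int i + int k"
  show "?S \<subseteq> {-B..B}"
  proof
    fix r assume "r \<in> ?S"
    then have "\<bar>\<lfloor>real_of_int (int i - int k - (2 * int k + 1) * r) / 2\<rfloor>\<bar> \<le> int n"
      by (auto simp: qbinom_def split: if_splits)
    moreover have "\<lfloor>real_of_int x / 2\<rfloor> = x div 2" for x
      using floor_divide_of_int_eq[of x 2] by simp
    ultimately have "\<bar>(int i - int k - (2 * int k + 1) * r) div 2\<bar> \<le> int n"
      by metis
    moreover have "\<bar>y\<bar> \<le> B" if "\<bar>(int i - int k - y) div 2\<bar> \<le> int n" for y
      using that unfolding B_def by linarith
    ultimately have "\<bar>(2 * int k + 1) * r\<bar> \<le> B" by blast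
    moreover have "\<bar>r\<bar> \<le> \<bar>(2 * int k + 1) * r\<bar>"
      unfolding abs_mult by (rule mult_le_cancel_right1[THEN iffD2]) auto
    ultimately show "r \<in> {-B..B}" by auto
  qed
qed simp

text \<open>The quadratic exponent on the right-hand side is a nonnegative integer, so
  that the integer division by \<open>2\<close> is exact.\<close>

lemma right_exponent:
  fixes r i k :: int
  assumes "1 \<le> i" "i \<le> k"
  shows "even (r * ((2 * k + 1) * r + 2 * k - 2 * i + 1))"
    and "0 \<le> r * ((2 * k + 1) * r + 2 * k - 2 * i + 1)"
proof -
  show "even (r * ((2 * k + 1) * r + 2 * k - 2 * i + 1))" by simp
  show "0 \<le> r * ((2 * k + 1) * r + 2 * k - 2 * i + 1)"
  proof (cases "r \<ge> 0")
    case True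
    then have "0 \<le> (2 * k + 1) * r" using assms by simp
    then have "0 \<le> (2 * k + 1) * r + 2 * k - 2 * i + 1" using assms by linarith
    then show ?thesis using True by (rule mult_nonneg_nonneg[rotated])
  next
    case False
    then have "(2 * k + 1) * r \<le> (2 * k + 1) * (-1)"
      using assms by (intro mult_left_mono) auto
    then have "(2 * k + 1) * r \<le> - (2 * k + 1)" by simp
    then have "(2 * k + 1) * r + 2 * k - 2 * i + 1 \<le> 0" using assms by linarith
    then show ?thesis using False by (intro mult_nonpos_nonpos) auto
  qed
qed

end

theory Submission
  imports Defs
begin

text \<open>
  Bailey's lemma, applied \<open>p\<close> times, reduces the identity to its version without the outer sum, where
  the inner sum equals an alternating sum of \<open>q\<close>-binomial coefficients with top \<open>2m\<^sub>1\<close>. That identity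
  is a count of weighted lattice paths of length \<open>L = 2m\<^sub>1\<close> in a strip with heights \<open>1, \<dots>, 2k\<close>, starting
  at \<open>i\<close> and ending at \<open>k\<close> or \<open>k + 1\<close>. With the starting point fixed and the end point varying, the
  method of images gives the alternating sum: it satisfies the three-term recurrence obtained by removing the last
  step. With the end fixed, the starting point varying and \<open>n\<^sub>1\<close> marking the number of weighted extrema,
  the multiple sum satisfies the recurrence obtained by removing the first step; this follows from the
  Pascal rule by induction on \<open>k\<close>, splitting off \<open>n\<^sub>1\<close>. Cutting the paths at position \<open>x\<close> gives a
  bilinear pairing of the two families that does not depend on \<open>x\<close>; the cuts at \<open>x = 0\<close> and \<open>x = L\<close>
  are the two sides.
\<close>

section \<open>Products, finite sums and tuples of bounded size\<close>

lemma qpoch_Suc: "qpoch q q (Suc m) = qpoch q q m * (1 - q ^ Suc m)"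
  by (simp add: qpoch_def)

lemma qpoch_0 [simp]: "qpoch a q 0 = 1"
  by (simp add: qpoch_def)

text \<open>The adjacency operator of the path 1, ..., K is symmetric; the zeros at 0 and K + 1
  remove the boundary terms of the index shift.\<close>

lemma sum_neighbours_swap:
  fixes G R :: "int \<Rightarrow> 'a::comm_semiring_0"
  assumes "G 0 = 0" "R 0 = 0" "G (K + 1) = 0" "R (K + 1) = 0"
  shows "(\<Sum>b=1..K. G b * (R (b - 1) + R (b + 1))) = (\<Sum>b=1..K. (G (b - 1) + G (b + 1)) * R b)"
proof -
  have shift: "(\<Sum>b=1..K. f b * g (b - 1)) = (\<Sum>b=1..K. f (b + 1) * g b)"
    if "g 0 = 0" "f (K + 1) = 0" for f g :: "int \<Rightarrow> 'a"
  proof -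
    have "(\<Sum>b=1..K. f b * g (b - 1)) = (\<Sum>b=0..K-1. f (b + 1) * g b)"
      by (rule sum.reindex_bij_witness[of _ "\<lambda>b. b + 1" "\<lambda>b. b - 1"]) auto
    also have "\<dots> = (\<Sum>b=0..K. f (b + 1) * g b)"
    proof (intro sum.mono_neutral_left ballI)
      fix b assume "b \<in> {0..K} - {0..K-1}"
      then have "b = K" by auto
      then show "f (b + 1) * g b = 0" using that by simp
    qed auto
    also have "\<dots> = (\<Sum>b=1..K. f (b + 1) * g b)"
    proof (intro sum.mono_neutral_right ballI)
      fix b assume "b \<in> {0..K} - {1..K}"
      then have "b = 0" by auto
      then show "f (b + 1) * g b = 0" using that by simp
    qed auto
    finally show ?thesis .
  qed
  show ?thesis
    using shift[of R G] shift[of G R] assms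
    by (simp add: distrib_left distrib_right sum.distrib mult.commute add.commute)
qed

lemma sum_supp_eq_sum:
  assumes "finite S" "S \<subseteq> A" "\<And>x. x \<in> A \<Longrightarrow> x \<notin> S \<Longrightarrow> f x = 0"
  shows "sum_supp A f = sum f S"
proof -
  have "sum_supp A f = (\<Sum>x\<in>S. if x \<in> A then f x else 0)"
    unfolding sum_supp_def using assms by (intro Sum_any.expand_superset) auto
  also have "\<dots> = sum f S" using assms by (intro sum.cong) auto
  finally show ?thesis .
qed

lemma power_int_add_nonneg:
  fixes q :: "'a::field"
  assumes "a \<ge> 0" "b \<ge> 0"
  shows "q powi (a + b) = q powi a * q powi b"
  using assms by (simp add: power_int_def nat_add_distrib power_add)

lemma finite_inner_tuples_head:
  assumes "k \<ge> 1"
  shows "finite {\<nu> \<in> inner_tuples k. \<nu> 1 \<le> C}"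
proof (rule finite_subset)
  show "{\<nu> \<in> inner_tuples k. \<nu> 1 \<le> C} \<subseteq> {1..k} \<rightarrow>\<^sub>E {0..C}"
  proof
    fix \<nu> assume "\<nu> \<in> {\<nu> \<in> inner_tuples k. \<nu> 1 \<le> C}"
    then have \<nu>: "\<nu> \<in> {1..k} \<rightarrow>\<^sub>E {0..}" and mono: "\<And>j. j \<in> {1..<k} \<Longrightarrow> \<nu> (j + 1) \<le> \<nu> j"
      and \<nu>1: "\<nu> 1 \<le> C"
      by (auto simp: inner_tuples_def)
    have "\<nu> j \<le> \<nu> 1" if "j \<in> {1..k}" for j
    proof -
      have "1 \<le> j" "j \<le> k" using that by auto
      then show ?thesis
      proof (induction rule: dec_induct)
        case (step l)
        then show ?case using mono[of l] by simp
      qed simp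
    qed
    then show "\<nu> \<in> {1..k} \<rightarrow>\<^sub>E {0..C}"
      using \<nu> \<nu>1 by (fastforce simp: PiE_iff)
  qed
qed (auto intro: finite_PiE)

lemma finite_outer_tuples_last:
  assumes "p \<ge> 1"
  shows "finite {m \<in> outer_tuples p. m p \<le> C}"
proof (rule finite_subset)
  show "{m \<in> outer_tuples p. m p \<le> C} \<subseteq> {1..p} \<rightarrow>\<^sub>E {0..C}"
  proof
    fix m assume "m \<in> {m \<in> outer_tuples p. m p \<le> C}"
    then have m: "m \<in> {1..p} \<rightarrow>\<^sub>E {0..}" and mono: "\<And>j. j \<in> {1..<p} \<Longrightarrow> m j \<le> m (j + 1)"
      and mp: "m p \<le> C"
      by (auto simp: outer_tuples_def)
    have "m j \<le> m p" if "j \<in> {1..p}" for j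
    proof -
      have "j \<le> p" "1 \<le> j" using that by auto
      then show ?thesis
      proof (induction rule: inc_induct)
        case (step l)
        then show ?case using mono[of l] by simp
      qed simp
    qed
    then show "m \<in> {1..p} \<rightarrow>\<^sub>E {0..C}"
      using m mp by (fastforce simp: PiE_iff)
  qed
qed (auto intro: finite_PiE)

section \<open>Splitting off the first entry of an inner tuple\<close>

lemma sum_lessThan_split_first:
  "(\<Sum>j=1..<Suc (Suc k). f j) = f 1 + (\<Sum>j=1..<Suc k. f (Suc j))"
  for f :: "nat \<Rightarrow> 'a::comm_monoid_add"
  by (simp add: sum.atLeast_Suc_lessThan sum.shift_bounds_Suc_ivl del: sum.op_ivl_Suc)

lemma prod_lessThan_split_first:
  "(\<Prod>j=1..<Suc (Suc k). f j) = f 1 * (\<Prod>j=1..<Suc k. f (Suc j))"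
  for f :: "nat \<Rightarrow> 'a::comm_monoid_mult"
  by (simp add: prod.atLeast_Suc_lessThan prod.shift_bounds_Suc_ivl del: prod.op_ivl_Suc)

text \<open>Indices out of range get \<open>undefined\<close>, as the extensional functions in
  \<open>inner_tuples\<close> require; this makes \<open>tuple_cons\<close> and
  \<open>tuple_tail\<close> mutually inverse.\<close>

definition tuple_cons :: "nat \<Rightarrow> int \<Rightarrow> (nat \<Rightarrow> int) \<Rightarrow> nat \<Rightarrow> int" where
  "tuple_cons k v \<mu> j = (if j = 1 then v else if 2 \<le> j \<and> j \<le> Suc k then \<mu> (j - 1) else undefined)"

definition tuple_tail :: "nat \<Rightarrow> (nat \<Rightarrow> int) \<Rightarrow> nat \<Rightarrow> int" where
  "tuple_tail k \<nu> j = (if 1 \<le> j \<and> j \<le> k then \<nu> (Suc j) else undefined)"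

lemma inner_tuples_iff:
  "\<nu> \<in> inner_tuples k \<longleftrightarrow> (\<forall>j. (1 \<le> j \<and> j \<le> k \<longrightarrow> \<nu> j \<ge> 0) \<and> (\<not> (1 \<le> j \<and> j \<le> k) \<longrightarrow> \<nu> j = undefined))
     \<and> \<nu> k = 0 \<and> (\<forall>j. 1 \<le> j \<and> j < k \<longrightarrow> \<nu> (Suc j) \<le> \<nu> j)"
  by (auto simp: inner_tuples_def PiE_iff extensional_def)

lemma tuple_cons_in:
  assumes "\<mu> \<in> inner_tuples k" "k \<ge> 1" "\<mu> 1 \<le> v"
  shows "tuple_cons k v \<mu> \<in> inner_tuples (Suc k)"
  unfolding inner_tuples_iff
proof (intro conjI allI impI)
  have \<mu>: "\<And>j. 1 \<le> j \<Longrightarrow> j \<le> k \<Longrightarrow> \<mu> j \<ge> 0" "\<mu> k = 0" "\<And>j. 1 \<le> j \<Longrightarrow> j < k \<Longrightarrow> \<mu> (Suc j) \<le> \<mu> j"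
    using assms by (auto simp: inner_tuples_iff)
  have "0 \<le> v" using \<mu>(1)[of 1] assms by linarith
  then show "0 \<le> tuple_cons k v \<mu> j" if "1 \<le> j \<and> j \<le> Suc k" for j
    using that \<mu>(1)[of "j - 1"] by (auto simp: tuple_cons_def)
  show "tuple_cons k v \<mu> j = undefined" if "\<not> (1 \<le> j \<and> j \<le> Suc k)" for j
    using that by (auto simp: tuple_cons_def)
  show "tuple_cons k v \<mu> (Suc k) = 0"
    using \<mu>(2) assms by (simp add: tuple_cons_def)
  show "tuple_cons k v \<mu> (Suc j) \<le> tuple_cons k v \<mu> j" if "1 \<le> j \<and> j < Suc k" for j
    using that assms \<mu>(3)[of "j - 1"] by (auto simp: tuple_cons_def)
qed

lemma tuple_tail_in:
  assumes "\<nu> \<in> inner_tuples (Suc k)" "k \<ge> 1"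
  shows "tuple_tail k \<nu> \<in> inner_tuples k"
  using assms unfolding inner_tuples_iff tuple_tail_def by auto

lemma tuple_cons_tail:
  assumes "\<nu> \<in> inner_tuples (Suc k)"
  shows "tuple_cons k (\<nu> 1) (tuple_tail k \<nu>) = \<nu>"
proof
  fix j
  show "tuple_cons k (\<nu> 1) (tuple_tail k \<nu>) j = \<nu> j"
    using assms unfolding inner_tuples_iff tuple_cons_def tuple_tail_def by auto
qed

lemma tuple_tail_cons:
  assumes "\<mu> \<in> inner_tuples k"
  shows "tuple_tail k (tuple_cons k v \<mu>) = \<mu>"
proof
  fix j
  show "tuple_tail k (tuple_cons k v \<mu>) j = \<mu> j"
    using assms unfolding inner_tuples_iff tuple_cons_def tuple_tail_def by auto
qed

section \<open>q-binomial coefficients and their centred form\<close>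

locale not_root_of_unity =
  fixes q :: "'a::field"
  assumes power_neq_1: "j \<ge> 1 \<Longrightarrow> q ^ j \<noteq> 1"
begin

lemma qpoch_nonzero [simp]: "qpoch q q m \<noteq> 0"
proof -
  have "1 - q * q ^ j \<noteq> 0" for j
    using power_neq_1[of "Suc j"] by simp
  then show ?thesis by (simp add: qpoch_def)
qed

lemma qbinom_nat: "qbinom q (int (b + c)) (int b) = qpoch q q (b + c) / (qpoch q q b * qpoch q q c)"
  by (simp add: qbinom_def nat_add_distrib)

lemma qbinom_eq_0: "b < 0 \<or> a < b \<Longrightarrow> qbinom q a b = 0"
  by (auto simp: qbinom_def)

lemma qbinom_self: "a \<ge> 0 \<Longrightarrow> qbinom q a a = 1"
  by (simp add: qbinom_def)

lemma qbinom_0_right: "a \<ge> 0 \<Longrightarrow> qbinom q a 0 = 1"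
  by (simp add: qbinom_def)

lemma qbinom_symmetric: "qbinom q a (a - b) = qbinom q a b"
  by (simp add: qbinom_def mult.commute)

text \<open>The last factors of (q;q)_a and (q;q)_b are cancelled. Outside 1 <= b <= a both sides
  vanish; for b <= 0 the left factor does, because \<open>nat b = 0\<close>.\<close>

lemma qbinom_absorb:
  assumes "a \<ge> 1"
  shows "(1 - q ^ nat b) * qbinom q a b = (1 - q ^ nat a) * qbinom q (a - 1) (b - 1)"
proof (cases "1 \<le> b \<and> b \<le> a")
  case True
  define m c where "m = nat (b - 1)" and "c = nat (a - b)"
  have b: "b = int (Suc m)" and a: "a = int (Suc m + c)"
    using True by (auto simp: m_def c_def)
  have *: "a - 1 = int (m + c)" "b - 1 = int m" using a b by auto
  have "qbinom q (a - 1) (b - 1) = qpoch q q (m + c) / (qpoch q q m * qpoch q q c)"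
    unfolding * by (rule qbinom_nat)
  moreover have "qbinom q a b = qpoch q q (Suc m + c) / (qpoch q q (Suc m) * qpoch q q c)"
    unfolding a b by (rule qbinom_nat)
  moreover have "nat a = Suc (m + c)" "nat b = Suc m" using a b by auto
  moreover have "1 - q ^ Suc m \<noteq> 0" using power_neq_1[of "Suc m"] by simp
  ultimately show ?thesis
    by (simp add: qpoch_Suc del: power_Suc)
next
  case False
  then show ?thesis using assms by (cases "b \<le> 0") (auto simp: qbinom_eq_0)
qed

lemma qbinom_absorb':
  assumes "a \<ge> 1"
  shows "(1 - q ^ nat (a - b)) * qbinom q a b = (1 - q ^ nat a) * qbinom q (a - 1) b"
  using qbinom_absorb[OF assms, of "a - b"] qbinom_symmetric[of a b]
    qbinom_symmetric[of "a - 1" b]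
  by (simp add: algebra_simps)

text \<open>The case \<open>a = b = 0\<close> must be excluded, because \<open>qbinom q (-1) 0 = 0\<close>.\<close>

lemma qbinom_pascal:
  assumes "a \<noteq> 0 \<or> b \<noteq> 0"
  shows "qbinom q a b = qbinom q (a - 1) (b - 1) + q ^ nat b * qbinom q (a - 1) b"
proof (cases "0 \<le> b \<and> b \<le> a")
  case True
  then have a: "a \<ge> 1" using assms by auto
  have nz: "1 - q ^ nat a \<noteq> 0" using power_neq_1[of "nat a"] a by simp
  \<comment> \<open>This splits 1 - q^a into (1 - q^b) + q^b (1 - q^(a-b)); the two absorption rules
    treat the two parts.\<close>
  have "q ^ nat a = q ^ nat b * q ^ nat (a - b)"
    using True by (simp flip: power_add nat_add_distrib)
  then have "(1 - q ^ nat a) * qbinom q a b =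
      (1 - q ^ nat b) * qbinom q a b + q ^ nat b * ((1 - q ^ nat (a - b)) * qbinom q a b)"
    by (simp add: algebra_simps)
  also have "\<dots> = (1 - q ^ nat a) * (qbinom q (a - 1) (b - 1) + q ^ nat b * qbinom q (a - 1) b)"
    unfolding qbinom_absorb[OF a] qbinom_absorb'[OF a] by (simp add: algebra_simps)
  finally show ?thesis using nz by simp
next
  case False
  then show ?thesis by (auto simp: qbinom_eq_0)
qed

text \<open>The \<^emph>\<open>centred\<close> \<open>q\<close>-binomial coefficient counts lattice paths with \<open>x\<close> steps \<open>\<pm>1\<close>
  and total displacement \<open>d\<close>; it vanishes if the parities of \<open>x\<close> and \<open>d\<close> differ.\<close>

definition qpaths :: "nat \<Rightarrow> int \<Rightarrow> 'a" where
  "qpaths x d = (if even (int x - d) then qbinom q (int x) ((int x - d) div 2) else 0)"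

lemma qpaths_eq_0: "\<bar>d\<bar> > int x \<Longrightarrow> qpaths x d = 0"
  unfolding qpaths_def by (cases "even (int x - d)") (auto intro!: qbinom_eq_0, presburger+)

lemma qpaths_uminus: "qpaths x (- d) = qpaths x d"
proof -
  have "(int x + d) div 2 = int x - (int x - d) div 2" if "even (int x - d)"
    using that by presburger
  then show ?thesis
    using qbinom_symmetric[of "int x" "(int x - d) div 2"] by (auto simp: qpaths_def)
qed

lemma qpaths_0: "qpaths 0 d = (if d = 0 then 1 else 0)"
  by (auto simp: qpaths_def qbinom_def)

text \<open>The Pascal rule with its factor q^j written as 1 - (1 - q^j); absorption turns the
  second part into a term two steps back, the weight correction for a turn at position x. At x = 0
  the factor 1 - q^x kills the truncated index \<open>x - 1\<close>.\<close>

lemma qpaths_Suc: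
  "qpaths (Suc x) d = qpaths x (d - 1) + qpaths x (d + 1) - (1 - q ^ x) * qpaths (x - 1) d"
proof (cases "even (int (Suc x) - d)")
  case False
  then show ?thesis by (cases x) (auto simp: qpaths_def)
next
  case True
  define j where "j = (int (Suc x) - d) div 2"
  have d: "d = int (Suc x) - 2 * j" using True by (simp add: j_def)
  have 1: "qpaths (Suc x) d = qbinom q (int (Suc x)) j"
    "qpaths x (d - 1) = qbinom q (int x) j" "qpaths x (d + 1) = qbinom q (int x) (j - 1)"
    by (auto simp: qpaths_def d)
  have 2: "(1 - q ^ x) * qpaths (x - 1) d = (1 - q ^ nat j) * qbinom q (int x) j"
  proof (cases "x = 0")
    case True
    then show ?thesis by (auto simp: qbinom_def)
  next
    case False
    then have "qpaths (x - 1) d = qbinom q (int x - 1) (j - 1)"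
      by (auto simp: qpaths_def d of_nat_diff)
    then show ?thesis using qbinom_absorb[of "int x" j] False by simp
  qed
  show ?thesis
    using qbinom_pascal[of "int (Suc x)" j] unfolding 1 2 by (simp add: algebra_simps)
qed

text \<open>Since d = (x - j) - j, one has 1 - q^d = (1 - q^(x-j)) - q^d (1 - q^j), and both
  absorption rules apply. This is the source of the cancellation of images at a wall.\<close>

lemma qpaths_boundary:
  assumes "x \<ge> 1" "d \<ge> 0"
  shows "(1 - q ^ nat d) * qpaths x d =
    (1 - q ^ x) * (qpaths (x - 1) (d - 1) - q ^ nat d * qpaths (x - 1) (d + 1))"
proof (cases "even (int x - d) \<and> d \<le> int x")
  case False
  then consider "odd (int x - d)" | "d > int x" by linarith
  then show ?thesis
  proof cases
    case 1
    then show ?thesis using assms by (auto simp: qpaths_def of_nat_diff)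
  next
    case 2
    then show ?thesis using assms by (simp add: qpaths_eq_0)
  qed
next
  case True
  define j where "j = (int x - d) div 2"
  have d: "d = int x - 2 * j" and j: "j \<ge> 0" using True by (auto simp: j_def)
  have 1: "qpaths x d = qbinom q (int x) j"
    "qpaths (x - 1) (d - 1) = qbinom q (int x - 1) j"
    "qpaths (x - 1) (d + 1) = qbinom q (int x - 1) (j - 1)"
    using assms by (auto simp: qpaths_def d of_nat_diff)
  have "q ^ nat d * q ^ nat j = q ^ nat (int x - j)"
    using assms d j by (simp flip: power_add nat_add_distrib)
  then have "(1 - q ^ nat d) * qbinom q (int x) j =
    (1 - q ^ nat (int x - j)) * qbinom q (int x) j
      - q ^ nat d * ((1 - q ^ nat j) * qbinom q (int x) j)"
    by (simp add: algebra_simps)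
  also have "\<dots> = (1 - q ^ x) * (qbinom q (int x - 1) j - q ^ nat d * qbinom q (int x - 1) (j - 1))"
  proof -
    have x: "1 \<le> int x" using assms by simp
    show ?thesis
      unfolding qbinom_absorb[OF x] qbinom_absorb'[OF x] by (simp add: algebra_simps)
  qed
  finally show ?thesis unfolding 1 .
qed

subsection \<open>The inner sum\<close>

text \<open>\<open>ferm k i L N\<close> is the part of the inner sum with \<open>n\<^sub>1 = N\<close>, with \<open>2m\<^sub>1\<close> replaced by an integer
  \<open>L\<close>, and with the paper's \<open>k\<close> equal to the first argument plus one. Splitting off \<open>n\<^sub>1\<close> turns
  \<open>(k, i, L)\<close> into \<open>(k - 1, i - 1, L - 2n\<^sub>1)\<close>. The equations also give values for \<open>i\<close> one larger than
  the paper's \<open>k\<close>; they agree with those for \<open>i = k\<close>.\<close>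

fun ferm :: "nat \<Rightarrow> nat \<Rightarrow> int \<Rightarrow> nat \<Rightarrow> 'a" where
  "ferm 0 i L N = (if N = 0 \<and> L \<ge> 0 then 1 else 0)"
| "ferm (Suc k) i L N =
    (if i \<le> 1
     then q ^ N * (q ^ N\<^sup>2 * (\<Sum>n\<le>N. qbinom q (L - 1 - int N - int n) (int N - int n)
                              * ferm k 1 (L - 1 - 2 * int N) n))
     else q ^ N\<^sup>2 * (\<Sum>n\<le>N. qbinom q (L - int N - int n) (int N - int n)
                              * ferm k (i - 1) (L - 2 * int N) n))"

declare ferm.simps(2) [simp del]

lemma ferm_Suc:
  "h \<ge> 1 \<Longrightarrow> ferm (Suc k) (Suc h) L N =
    q ^ N\<^sup>2 * (\<Sum>n\<le>N. qbinom q (L - int N - int n) (int N - int n) * ferm k h (L - 2 * int N) n)"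
  by (simp add: ferm.simps(2))

lemma ferm_eq_0:
  assumes "2 * int N > L"
  shows "ferm k i L N = 0"
proof (cases k)
  case (Suc k')
  have "qbinom q (L - 1 - int N - int n) (int N - int n) = 0"
    "qbinom q (L - int N - int n) (int N - int n) = 0" for n
    using assms by (auto intro!: qbinom_eq_0)
  then show ?thesis by (simp add: Suc ferm.simps(2))
qed (use assms in auto)

text \<open>Heights k + 1 and k + 2 are mirror images in the middle of the strip, so in
  \<open>ferm_rec\<close> the upward neighbour of the top height is that height itself.\<close>

lemma ferm_top: "ferm k (k + 2) L N = ferm k (k + 1) L N"
proof (induction k arbitrary: L N)
  case (Suc k)
  then show ?case by (simp add: ferm_Suc)
qed simp

lemma ferm_Suc_1: "ferm (Suc k) 1 L N = q ^ N * ferm (Suc k) 2 (L - 1) N"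
  by (simp add: ferm.simps(2))

text \<open>At the wall only the upward step is possible. For k = 0 the bound on L keeps the cut-off
  of \<open>ferm 0\<close> at negative lengths from separating the two sides.\<close>

lemma ferm_1: "L \<ge> 1 \<Longrightarrow> ferm k 1 L N = q ^ N * ferm k 2 (L - 1) N"
  by (cases k) (simp_all add: ferm_Suc_1[unfolded One_nat_def])

text \<open>Removing the first step moves the N weighted extrema by one position, whence q^N. The
  corrections concern the paths starting i, i - 1, i: their turn at position 1 must contribute q and
  count in N, so q^(2N-1) with N - 1 further extrema replaces q^(2N) with N. The algebra uses the
  Pascal rule twice, before and after the induction hypothesis on k.\<close>

lemma ferm_rec:
  assumes "2 \<le> i" "i \<le> k + 1" "L \<ge> 1"
  shows "ferm k i L N =
    q ^ N * (ferm k (i + 1) (L - 1) N + ferm k (i - 1) (L - 1) N)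
    - q ^ (2 * N) * ferm k i (L - 2) N
    + (if N = 0 then 0 else q ^ (2 * N - 1) * ferm k i (L - 2) (N - 1))"
  using assms
proof (induction k arbitrary: i L N)
  case 0
  then show ?case by simp
next
  case (Suc k)
  obtain h where h: "i = Suc h" "h \<ge> 1" "h \<le> k + 1"
    using Suc.prems by (cases i) auto
  define last where "last = (if N = 0 then 0 else q ^ (2 * N - 1) * ferm (Suc k) i (L - 2) (N - 1))"
  \<comment> \<open>The inner length is L - 2N: if negative, all terms vanish; if zero, only n = 0
    survives; if positive, the induction hypothesis applies.\<close>
  consider "L < 2 * int N" | "L = 2 * int N" | "L > 2 * int N" by linarith
  then show ?case
  proof cases
    case 1
    then show ?thesis by (simp add: ferm_eq_0)
  next
    case 2
    then obtain N' where N': "N = Suc N'" using Suc.prems by (cases N) auto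
    have *: "ferm (Suc k) i (2 * int M) M = q ^ M\<^sup>2 * ferm k h 0 0" for M
    proof -
      have "(\<Sum>n\<le>M. qbinom q (2 * int M - int M - int n) (int M - int n) * ferm k h 0 n)
          = (\<Sum>n\<in>{0}. qbinom q (2 * int M - int M - int n) (int M - int n) * ferm k h 0 n)"
        by (intro sum.mono_neutral_right) (auto simp: ferm_eq_0)
      then show ?thesis using h by (simp add: ferm_Suc qbinom_self)
    qed
    have "ferm (Suc k) i (L - 2) (N - 1) = q ^ (N - 1)\<^sup>2 * ferm k h 0 0"
      using *[of "N - 1"] N' 2 by simp
    moreover have "q ^ N\<^sup>2 = q ^ (2 * N - 1) * q ^ (N - 1)\<^sup>2"
      unfolding power_add[symmetric] N' by (simp add: power2_eq_square mult_2 add.assoc)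
    moreover have "ferm (Suc k) i L N = q ^ N\<^sup>2 * ferm k h 0 0" using *[of N] 2 by simp
    ultimately show ?thesis using 2 N' by (simp add: ferm_eq_0)
  next
    case 3
    define L' where "L' = L - 2 * int N"
    have L': "L' \<ge> 1" using 3 by (simp add: L'_def)
    define w where "w n = qbinom q (L - 1 - int N - int n) (int N - int n)" for n
    \<comment> \<open>Lowering N by 1 and L by 2 keeps the inner length L - 2N, so this term is a
      sum over the same values \<open>ferm k h L' n\<close>.\<close>
    have last: "last = q ^ N\<^sup>2 *
      (\<Sum>n\<le>N. qbinom q (L - int N - int n - 1) (int N - int n - 1) * ferm k h L' n)"
    proof (cases N)
      case 0
      then show ?thesis by (simp add: last_def qbinom_eq_0)
    next
      case (Suc M)
      have qN: "q ^ (2 * N - 1) * q ^ M\<^sup>2 = q ^ N\<^sup>2"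
        unfolding power_add[symmetric] Suc by (simp add: power2_eq_square mult_2 add.assoc)
      have "last = q ^ N\<^sup>2 *
          (\<Sum>n\<le>M. qbinom q (L - 2 - int M - int n) (int M - int n) * ferm k h (L - 2 - 2 * int M) n)"
        unfolding qN[symmetric] using h Suc by (simp add: last_def ferm_Suc mult.assoc)
      also have "(\<Sum>n\<le>M. qbinom q (L - 2 - int M - int n) (int M - int n) * ferm k h (L - 2 - 2 * int M) n)
          = (\<Sum>n\<le>M. qbinom q (L - int N - int n - 1) (int N - int n - 1) * ferm k h L' n)"
        using Suc by (intro sum.cong refl arg_cong2[where f = "(*)"] arg_cong2[where f = "qbinom q"]
            arg_cong2[where f = "ferm k h"]) (auto simp: L'_def)
      also have "\<dots> = (\<Sum>n\<le>N. qbinom q (L - int N - int n - 1) (int N - int n - 1) * ferm k h L' n)"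
        using Suc by (simp add: qbinom_eq_0)
      finally show ?thesis .
    qed
    have "ferm (Suc k) i L N - last = q ^ N\<^sup>2 * (\<Sum>n\<le>N.
       (qbinom q (L - int N - int n) (int N - int n)
        - qbinom q (L - int N - int n - 1) (int N - int n - 1)) * ferm k h L' n)"
      using h unfolding last
      by (simp add: ferm_Suc L'_def sum_subtractf left_diff_distrib right_diff_distrib)
    also have "\<dots> = q ^ N\<^sup>2 * (\<Sum>n\<le>N. q ^ (N - n) * w n * ferm k h L' n)"
    proof (intro arg_cong[where f = "\<lambda>x. q ^ N\<^sup>2 * x"] sum.cong refl)
      fix n assume n: "n \<in> {..N}"
      \<comment> \<open>First use of the Pascal rule; its exceptional case would force L =
        2N.\<close>
      have "qbinom q (L - int N - int n) (int N - int n) =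
        qbinom q (L - int N - int n - 1) (int N - int n - 1) + q ^ (N - n) * w n"
        using qbinom_pascal[of "L - int N - int n" "int N - int n"] 3 n
        by (auto simp: w_def algebra_simps nat_diff_distrib')
      then show "(qbinom q (L - int N - int n) (int N - int n)
        - qbinom q (L - int N - int n - 1) (int N - int n - 1)) * ferm k h L' n
        = q ^ (N - n) * w n * ferm k h L' n" by simp
    qed
    finally have diff: "ferm (Suc k) i L N = q ^ N\<^sup>2 * (\<Sum>n\<le>N. q ^ (N - n) * w n * ferm k h L' n) + last"
      by (simp add: algebra_simps)
    have fold: "q ^ N\<^sup>2 * (\<Sum>n\<le>N. w n * ferm k g (L' - 1) n) = ferm (Suc k) (Suc g) (L - 1) N"
      if "g \<ge> 1" for g
      using that by (simp add: ferm_Suc w_def L'_def algebra_simps)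
    have qN: "q ^ (N - n) * q ^ n = q ^ N" if "n \<le> N" for n
      using that by (simp flip: power_add)
    show ?thesis
    proof (cases "h = 1")
      case True
      have "(\<Sum>n\<le>N. q ^ (N - n) * w n * ferm k h L' n) = (\<Sum>n\<le>N. q ^ N * (w n * ferm k 2 (L' - 1) n))"
        using True L' by (intro sum.cong refl) (auto simp: ferm_1[unfolded One_nat_def] simp flip: qN)
      then have "ferm (Suc k) i L N = q ^ N * ferm (Suc k) (i + 1) (L - 1) N + last"
        using diff fold[of 2] True h by (simp flip: sum_distrib_left add: numeral_2_eq_2)
      \<comment> \<open>From the neighbour at height 1 the path can only step back to 2, so this
        contribution cancels the q^(2N) correction.\<close>
      moreover have "q ^ N * ferm (Suc k) (i - 1) (L - 1) N = q ^ (2 * N) * ferm (Suc k) i (L - 2) N"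
      proof -
        have "ferm (Suc k) 1 (L - 1) N = q ^ N * ferm (Suc k) 2 (L - 1 - 1) N"
          by (rule ferm_Suc_1)
        moreover have "i - 1 = 1" "i = 2" using True h by auto
        ultimately show ?thesis by (simp add: mult_2 power_add mult.assoc)
      qed
      ultimately show ?thesis unfolding last_def[symmetric] distrib_left by simp
    next
      case False
      define C where "C n = ferm k h (L' - 2) n" for n
      define A where "A n = ferm k (h + 1) (L' - 1) n + ferm k (h - 1) (L' - 1) n" for n
      define D where "D n = (if n = 0 then 0 else q ^ (N + n - 1) * w n * C (n - 1))" for n
      have "(\<Sum>n\<le>N. q ^ (N - n) * w n * ferm k h L' n) =
        (\<Sum>n\<le>N. q ^ N * (w n * A n) - q ^ (N + n) * w n * C n + D n)"
      proof (intro sum.cong refl)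
        fix n assume "n \<in> {..N}"
        then have n: "n \<le> N" by simp
        have f: "ferm k h L' n = q ^ n * A n - q ^ (2 * n) * C n
            + (if n = 0 then 0 else q ^ (2 * n - 1) * C (n - 1))"
          unfolding A_def C_def using Suc.IH[of h L' n] h False L' by simp
        have p1: "q ^ (N - n) * q ^ (2 * n) = q ^ (N + n)"
          unfolding power_add[symmetric] using n by (intro arg_cong[of _ _ "power q"]) auto
        have p2: "q ^ (N - n) * q ^ (2 * n - 1) = q ^ (N + n - 1)" if "n \<noteq> 0"
          unfolding power_add[symmetric] using n that by (intro arg_cong[of _ _ "power q"]) auto
        show "q ^ (N - n) * w n * ferm k h L' n =
            q ^ N * (w n * A n) - q ^ (N + n) * w n * C n + D n"
        proof (cases "n = 0")
          case True
          then show ?thesis unfolding f D_def by (simp add: algebra_simps)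
        next
          case False
          then show ?thesis
            unfolding f D_def qN[OF n, symmetric] p1[symmetric] p2[OF False, symmetric]
            by (simp add: algebra_simps)
        qed
      qed
      also have "\<dots> = q ^ N * (\<Sum>n\<le>N. w n * A n)
          - ((\<Sum>n\<le>N. q ^ (N + n) * w n * C n) - (\<Sum>n\<le>N. D n))"
        by (simp add: sum.distrib sum_subtractf sum_distrib_left)
      \<comment> \<open>Shifting n by one brings the last term of the induction hypothesis to the
        same \<open>C n\<close>. The added index n = N contributes nothing, since the lower entry of
        its \<open>qbinom\<close> is -1.\<close>
      also have "(\<Sum>n\<le>N. D n) =
          (\<Sum>n\<le>N. q ^ (N + n) * qbinom q (L - 2 - int N - int n) (int N - int n - 1) * C n)"
      proof (cases N)
        case 0
        then show ?thesis by (simp add: D_def qbinom_eq_0)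
      next
        case (Suc M)
        have "w (Suc n) = qbinom q (L - 2 - int N - int n) (int N - int n - 1)" for n
          by (simp add: w_def algebra_simps)
        then have "(\<Sum>n\<le>Suc M. D n) =
          (\<Sum>n\<le>M. q ^ (N + n) * qbinom q (L - 2 - int N - int n) (int N - int n - 1) * C n)"
          unfolding sum.atMost_Suc_shift by (simp add: D_def)
        then show ?thesis using Suc by (simp add: qbinom_eq_0)
      qed
      also have "(\<Sum>n\<le>N. q ^ (N + n) * w n * C n) - \<dots> =
          (\<Sum>n\<le>N. q ^ (2 * N) * (qbinom q (L - 2 - int N - int n) (int N - int n) * C n))"
        unfolding sum_subtractf[symmetric]
      proof (intro sum.cong refl)
        fix n assume "n \<in> {..N}"
        then have n: "n \<le> N" by simp
        show "q ^ (N + n) * w n * C n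
            - q ^ (N + n) * qbinom q (L - 2 - int N - int n) (int N - int n - 1) * C n
          = q ^ (2 * N) * (qbinom q (L - 2 - int N - int n) (int N - int n) * C n)"
        \<comment> \<open>Second use of the Pascal rule. Its exceptional case needs L' = 1, where
          \<open>C\<close> vanishes because its length is -1.\<close>
        proof (cases "L' = 1")
          case True
          then show ?thesis by (simp add: C_def ferm_eq_0)
        next
          case False
          then have "w n = qbinom q (L - 2 - int N - int n) (int N - int n - 1)
              + q ^ (N - n) * qbinom q (L - 2 - int N - int n) (int N - int n)"
            unfolding w_def
            using qbinom_pascal[of "L - 1 - int N - int n" "int N - int n"] L' n
            by (auto simp: L'_def algebra_simps nat_diff_distrib')
          moreover have "q ^ (N + n) * q ^ (N - n) = q ^ (2 * N)"
            unfolding power_add[symmetric] using n by (intro arg_cong[of _ _ "power q"]) auto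
          ultimately show ?thesis by (simp add: algebra_simps)
        qed
      qed
      finally have S: "(\<Sum>n\<le>N. q ^ (N - n) * w n * ferm k h L' n) =
        q ^ N * (\<Sum>n\<le>N. w n * A n)
        - q ^ (2 * N) * (\<Sum>n\<le>N. qbinom q (L - 2 - int N - int n) (int N - int n) * C n)"
        by (simp add: sum_distrib_left)
      have e1: "q ^ N\<^sup>2 * (\<Sum>n\<le>N. qbinom q (L - 2 - int N - int n) (int N - int n) * C n)
          = ferm (Suc k) i (L - 2) N"
        using h by (simp add: ferm_Suc C_def L'_def algebra_simps)
      have e2: "q ^ N\<^sup>2 * (\<Sum>n\<le>N. w n * A n) =
          ferm (Suc k) (i + 1) (L - 1) N + ferm (Suc k) (i - 1) (L - 1) N"
        using fold[of "h + 1"] fold[of "h - 1"] h False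
        by (simp add: A_def distrib_left sum.distrib)
      have e3: "x * (a * y - b * z) = a * (x * y) - b * (x * z)" for x y z a b :: 'a
        by (simp add: algebra_simps)
      have "q ^ N\<^sup>2 * (\<Sum>n\<le>N. q ^ (N - n) * w n * ferm k h L' n) =
          q ^ N * (ferm (Suc k) (i + 1) (L - 1) N + ferm (Suc k) (i - 1) (L - 1) N)
          - q ^ (2 * N) * ferm (Suc k) i (L - 2) N"
        unfolding S e3 e1 e2 ..
      then show ?thesis using diff by (simp add: last_def)
    qed
  qed
qed

subsection \<open>Images in a strip\<close>

text \<open>\<open>G\<close> counts the initial and \<open>R\<close> the final parts of paths cut at position \<open>x\<close>. The product \<open>G x b * R x b\<close> gives
  weight \<open>1\<close> instead of \<open>q ^ x\<close> to an extremum at the cut, which the second sum in the invariant \<open>I\<close> corrects;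
  \<open>\<chi>\<close> is the indicator of the heights from which the path can step outwards.\<close>

lemma pairing_constant:
  fixes G R :: "nat \<Rightarrow> int \<Rightarrow> 'a" and \<chi> :: "int \<Rightarrow> 'a"
  assumes G0: "\<And>x. G x 0 = 0" "\<And>x. G x (K + 1) = 0"
    and R0: "\<And>x. R x 0 = 0" "\<And>x. R x (K + 1) = 0"
    and G: "\<And>x b. x < L \<Longrightarrow> b \<in> {1..K} \<Longrightarrow>
        G (Suc x) b = G x (b - 1) + G x (b + 1) - \<chi> b * (1 - q ^ x) * G (x - 1) b"
    and R: "\<And>x b. x < L \<Longrightarrow> b \<in> {1..K} \<Longrightarrow>
        R x b = R (Suc x) (b - 1) + R (Suc x) (b + 1) - \<chi> b * (1 - q ^ Suc x) * R (Suc (Suc x)) b"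
    and R_end: "\<And>b. R (Suc L) b = 0"
  shows "(\<Sum>b=1..K. G 0 b * R 0 b) = (\<Sum>b=1..K. G L b * R L b)"
proof -
  define I where "I x = (\<Sum>b=1..K. G x b * R x b)
      - (1 - q ^ x) * (\<Sum>b=1..K. \<chi> b * G (x - 1) b * R (Suc x) b)" for x
  have "I x = I (Suc x)" if "x < L" for x
  proof -
    have "(\<Sum>b=1..K. G x b * R x b) = (\<Sum>b=1..K. G x b * (R (Suc x) (b - 1) + R (Suc x) (b + 1))
        - (1 - q ^ Suc x) * (\<chi> b * G x b * R (Suc (Suc x)) b))"
      by (intro sum.cong refl) (simp add: R[OF that] algebra_simps)
    also have "\<dots> = (\<Sum>b=1..K. G x b * (R (Suc x) (b - 1) + R (Suc x) (b + 1)))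
        - (1 - q ^ Suc x) * (\<Sum>b=1..K. \<chi> b * G x b * R (Suc (Suc x)) b)"
      by (simp add: sum_subtractf sum_distrib_left)
    \<comment> \<open>Symmetry of the adjacency operator transfers the step at the cut from the
      final part to the initial part.\<close>
    also have "(\<Sum>b=1..K. G x b * (R (Suc x) (b - 1) + R (Suc x) (b + 1)))
        = (\<Sum>b=1..K. (G x (b - 1) + G x (b + 1)) * R (Suc x) b)"
      by (intro sum_neighbours_swap G0 R0)
    also have "\<dots> = (\<Sum>b=1..K. G (Suc x) b * R (Suc x) b
        + (1 - q ^ x) * (\<chi> b * G (x - 1) b * R (Suc x) b))"
      by (intro sum.cong refl) (simp add: G[OF that] algebra_simps)
    finally show ?thesis
      by (simp add: I_def sum.distrib sum_distrib_left)
  qed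
  then have "x \<le> L \<Longrightarrow> I x = I 0" for x
    by (induction x) auto
  then have "I L = I 0" by blast
  \<comment> \<open>The correction in \<open>I\<close> drops out at both ends: 1 - q^0 = 0 at x = 0,
    and \<open>R (Suc L)\<close> vanishes at x = L.\<close>
  then show ?thesis by (simp add: I_def R_end)
qed

text \<open>Method of images: \<open>p\<close> is the width of the strip (\<open>p = 2k + 1\<close> in the theorem), \<open>i\<close> the starting
  height, \<open>b\<close> the final height and \<open>x\<close> the length of the path.\<close>

definition bose :: "int \<Rightarrow> int \<Rightarrow> int \<Rightarrow> nat \<Rightarrow> int \<Rightarrow> 'a" where
  "bose B p i x b =
     (\<Sum>s=-B..B. q ^ nat (s * (2 * s * p + p - 2 * i)) * qpaths x (b - i + 2 * p * s))
     - (\<Sum>s=-B..B. q ^ nat ((2 * s + 1) * (s * p + i)) * qpaths x (b + i + 2 * p * s))"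

lemma bose_Suc:
  "bose B p i (Suc x) b = bose B p i x (b - 1) + bose B p i x (b + 1) - (1 - q ^ x) * bose B p i (x - 1) b"
proof -
  have *: "c * qpaths (Suc x) (b + e + d) = c * qpaths x (b - 1 + e + d) + c * qpaths x (b + 1 + e + d)
       - (1 - q ^ x) * (c * qpaths (x - 1) (b + e + d))" for c d e
    unfolding qpaths_Suc by (simp add: algebra_simps)
  show ?thesis
    unfolding bose_def *[where e = i] *[where e = "-i", simplified]
    by (simp add: sum.distrib sum_subtractf right_diff_distrib sum_distrib_left)
qed

text \<open>The two factors of each product have the same sign, both for s >= 0 and for s <= -1.
  Hence \<open>nat\<close> in the exponents of \<open>bose\<close> truncates nothing.\<close>

lemma bose_exponents_nonneg:
  fixes s p i :: int
  assumes "0 < i" "2 * i < p"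
  shows "0 \<le> s * (2 * s * p + p - 2 * i)" "0 \<le> (2 * s + 1) * (s * p + i)"
proof -
  consider "s \<ge> 0" | "s \<le> -1" by linarith
  then have "0 \<le> s * (2 * s * p + p - 2 * i) \<and> 0 \<le> (2 * s + 1) * (s * p + i)"
  proof cases
    case 1
    then have "s * p \<ge> 0" using assms by simp
    then have "0 \<le> 2 * s * p + p - 2 * i" using assms by linarith
    then show ?thesis using assms 1 by simp
  next
    case 2
    have "s * p \<le> -1 * p" using 2 assms by (intro mult_right_mono) auto
    then show ?thesis using assms 2 by (auto intro!: mult_nonpos_nonpos)
  qed
  then show "0 \<le> s * (2 * s * p + p - 2 * i)" "0 \<le> (2 * s + 1) * (s * p + i)" by auto
qed

text \<open>Here e and e' are the weight exponents of an image and its mirror image in a wall. Since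
  e' - e = d, factoring out the lower power reduces the claim to \<open>qpaths_boundary\<close> for
  d or -d.\<close>

lemma image_boundary:
  fixes e e' d :: int
  assumes "x \<ge> 1" "e \<ge> 0" "e' \<ge> 0" "d = e' - e"
  shows "q ^ nat e * qpaths x d - q ^ nat e' * qpaths x d =
    (1 - q ^ x) * (q ^ nat e * qpaths (x - 1) (d - 1) - q ^ nat e' * qpaths (x - 1) (d + 1))"
proof (cases "d \<ge> 0")
  case True
  then have *: "q ^ nat e' = q ^ nat e * q ^ nat d"
    using assms by (simp flip: power_add nat_add_distrib)
  show ?thesis
    using arg_cong[OF qpaths_boundary[OF assms(1) True], of "\<lambda>y. q ^ nat e * y"]
    unfolding * by (simp add: algebra_simps)
next
  case False
  then have *: "q ^ nat e = q ^ nat e' * q ^ nat (- d)"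
    using assms by (simp flip: power_add nat_add_distrib)
  have "qpaths (x - 1) (- d - 1) = qpaths (x - 1) (d + 1)"
    "qpaths (x - 1) (- d + 1) = qpaths (x - 1) (d - 1)"
    using qpaths_uminus[of "x - 1" "d + 1"] qpaths_uminus[of "x - 1" "d - 1"] by simp_all
  then show ?thesis
    using arg_cong[OF qpaths_boundary[OF assms(1), of "- d"], of "\<lambda>y. q ^ nat e' * y"] False
    unfolding * qpaths_uminus by (simp add: algebra_simps)
qed

text \<open>Image s of the first family and image -s of the second are mirror images in the wall at
  height 0, so \<open>image_boundary\<close> applies to each pair. In \<open>bose_Suc\<close> at b =
  1 the value at height 0 then cancels the correction.\<close>

lemma bose_lower:
  assumes "0 < i" "2 * i < p" "x \<ge> 1"
  shows "bose B p i x 0 = (1 - q ^ x) * bose B p i (x - 1) 1"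
proof -
  have reflect: "(\<Sum>s=-B..B. f s) = (\<Sum>s=-B..B. f (- s))" for f :: "int \<Rightarrow> 'a"
    by (rule sum.reindex_bij_witness[of _ uminus uminus]) auto
  define e e' d where "e s = s * (2 * s * p + p - 2 * i)"
    and "e' s = (2 * (- s) + 1) * ((- s) * p + i)" and "d s = i - 2 * p * s" for s
  have ee: "e s \<ge> 0" "e' s \<ge> 0" for s
    unfolding e_def e'_def by (rule bose_exponents_nonneg[OF assms(1,2)])+
  have d: "d s = e' s - e s" for s
    by (simp add: e_def e'_def d_def algebra_simps)
  have bose: "bose B p i y b = (\<Sum>s=-B..B. q ^ nat (e s) * qpaths y (b - d s)
      - q ^ nat (e' s) * qpaths y (b + d s))" for y b
    unfolding bose_def sum_subtractf
    by (subst (2) reflect) (simp add: e_def e'_def d_def algebra_simps)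
  have "qpaths (x - 1) (1 - d s) = qpaths (x - 1) (d s - 1)" for s
    using qpaths_uminus[of "x - 1" "1 - d s"] by simp
  then show ?thesis
    unfolding bose sum_distrib_left
    using image_boundary[OF assms(3) ee d] by (simp add: qpaths_uminus add.commute)
qed

text \<open>Images s and -s - 1 are mirror images in the wall at height p. This pairing does not
  preserve the range -B..B; the bound on x puts the images at its ends out of reach.\<close>

lemma bose_upper:
  assumes "0 < i" "2 * i < p" "x \<ge> 1" "int x \<le> B"
  shows "bose B p i x p = (1 - q ^ x) * bose B p i (x - 1) (p - 1)"
proof -
  define e e' d where "e s = s * (2 * s * p + p - 2 * i)"
    and "e' s = (2 * (- s - 1) + 1) * ((- s - 1) * p + i)" and "d s = p - i + 2 * p * s" for s
  have ee: "e s \<ge> 0" "e' s \<ge> 0" for s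
    unfolding e_def e'_def by (rule bose_exponents_nonneg[OF assms(1,2)])+
  have d: "d s = e' s - e s" for s
    by (simp add: e_def e'_def d_def algebra_simps)
  have Bp: "B * 1 \<le> B * p" using assms by (intro mult_left_mono) auto
  have bose: "bose B p i y b = (\<Sum>s=-B..B. q ^ nat (e s) * qpaths y (b - p + d s)
      - q ^ nat (e' s) * qpaths y (b - p - d s))" if "0 \<le> b" "b \<le> p" "int y \<le> B" for y b
  proof -
    define f where "f s = q ^ nat ((2 * s + 1) * (s * p + i)) * qpaths y (b + i + 2 * p * s)" for s
    have "int y < b + i + 2 * p * B" "b + i + 2 * p * (- B - 1) < - int y"
      using that assms Bp unfolding right_diff_distrib mult.assoc mult.commute[of p] by linarith+
    then have *: "f B = 0" "f (- B - 1) = 0"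
      unfolding f_def by (simp_all add: qpaths_eq_0)
    have "(\<Sum>s=-B..B. f s) = (\<Sum>s=-B-1..B-1. f (- s - 1))"
      by (rule sum.reindex_bij_witness[of _ "\<lambda>s. - s - 1" "\<lambda>s. - s - 1"]) auto
    also have "\<dots> = (\<Sum>s=-B-1..B. f (- s - 1))"
    proof (intro sum.mono_neutral_left ballI)
      fix s assume "s \<in> {-B-1..B} - {-B-1..B-1}"
      then have "s = B" by auto
      then show "f (- s - 1) = 0" using * by simp
    qed auto
    also have "\<dots> = (\<Sum>s=-B..B. f (- s - 1))"
    proof (intro sum.mono_neutral_right ballI)
      fix s assume "s \<in> {-B-1..B} - {-B..B}"
      then have "s = - B - 1" by auto
      then show "f (- s - 1) = 0" using * by simp
    qed auto
    finally show ?thesis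
      unfolding bose_def sum_subtractf f_def by (simp add: e_def e'_def d_def algebra_simps)
  qed
  have flip: "qpaths (x - 1) (- 1 - d s) = qpaths (x - 1) (d s + 1)" for s
    using qpaths_uminus[of "x - 1" "d s + 1"] by (simp add: algebra_simps)
  have "bose B p i x p = (\<Sum>s=-B..B. q ^ nat (e s) * qpaths x (d s) - q ^ nat (e' s) * qpaths x (d s))"
    using bose[of p x] assms by (simp add: qpaths_uminus)
  also have "\<dots> = (\<Sum>s=-B..B. (1 - q ^ x) *
      (q ^ nat (e s) * qpaths (x - 1) (d s - 1) - q ^ nat (e' s) * qpaths (x - 1) (d s + 1)))"
    by (intro sum.cong refl image_boundary[OF assms(3) ee d])
  also have "\<dots> = (1 - q ^ x) * bose B p i (x - 1) (p - 1)"
    unfolding sum_distrib_left[symmetric] using bose[of "p - 1" "x - 1"] assms flip by simp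
  finally show ?thesis .
qed

text \<open>At length 0 only an image at b itself counts. Between the walls there is no image of the
  second family, and of the first only s = 0.\<close>

lemma bose_0:
  assumes "0 < i" "2 * i < p" "0 \<le> b" "b \<le> p" "B \<ge> 0"
  shows "bose B p i 0 b = (if b = i then 1 else 0)"
proof -
  have *: "s = 0" if "\<bar>2 * p * s\<bar> < 2 * p" for s
  proof -
    have "2 * p * \<bar>s\<bar> < 2 * p * 1" using that assms by (simp add: abs_mult)
    then have "\<bar>s\<bar> < 1" using assms by (subst (asm) mult_less_cancel_left_pos) auto
    then show ?thesis by simp
  qed
  have 1: "b - i + 2 * p * s = 0 \<longleftrightarrow> s = 0 \<and> b = i" for s
  proof
    assume h: "b - i + 2 * p * s = 0"
    then have "\<bar>2 * p * s\<bar> < 2 * p" using assms by linarith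
    then have "s = 0" by (rule *)
    then show "s = 0 \<and> b = i" using h by simp
  qed auto
  have 2: "b + i + 2 * p * s \<noteq> 0" for s
  proof
    assume h: "b + i + 2 * p * s = 0"
    then have "\<bar>2 * p * s\<bar> < 2 * p" using assms by linarith
    then have "s = 0" by (rule *)
    then show False using h assms by simp
  qed
  have "(\<Sum>s=-B..B. q ^ nat (s * (2 * s * p + p - 2 * i)) * qpaths 0 (b - i + 2 * p * s))
      = (\<Sum>s\<in>{0}. q ^ nat (s * (2 * s * p + p - 2 * i)) * qpaths 0 (b - i + 2 * p * s))"
    using assms by (intro sum.mono_neutral_right) (auto simp: qpaths_0 1)
  then show ?thesis unfolding bose_def by (simp add: qpaths_0 2)
qed

subsection \<open>Equality of the two sides without Bailey steps\<close>

text \<open>\<open>ferm\<close> indexed by the unfolded height \<open>b \<in> {1..2k}\<close>; the heights \<open>b\<close> and \<open>2k + 1 - b\<close> are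
  identified.\<close>

definition ferm_height :: "nat \<Rightarrow> int \<Rightarrow> int \<Rightarrow> nat \<Rightarrow> 'a" where
  "ferm_height k b L N =
     (if 1 \<le> b \<and> b \<le> 2 * int k then ferm (k - 1) (nat (min b (2 * int k + 1 - b))) L N else 0)"

lemma ferm_height_eq_0: "2 * int N > L \<Longrightarrow> ferm_height k b L N = 0"
  by (simp add: ferm_height_def ferm_eq_0)

lemma ferm_height_reflect: "ferm_height k (2 * int k + 1 - b) L N = ferm_height k b L N"
  by (auto simp: ferm_height_def min.commute)

text \<open>For j = k + 1 the folded height is k, and \<open>ferm_top\<close> supplies the
  equality.\<close>

lemma ferm_height_low:
  assumes "1 \<le> j" "j \<le> k + 1" "k \<ge> 1"
  shows "ferm_height k (int j) L N = ferm (k - 1) j L N"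
proof (cases "j = k + 1")
  case True
  have "ferm (k - 1) k L N = ferm (k - 1) (Suc k) L N"
    using ferm_top[of "k - 1" L N] assms by simp
  then show ?thesis using True assms by (simp add: ferm_height_def)
next
  case False
  then have "min (int j) (2 * int k + 1 - int j) = int j" using assms by auto
  then show ?thesis using assms False by (simp add: ferm_height_def)
qed

text \<open>The choice of \<open>\<chi>\<close> in \<open>pairing_constant\<close>: at heights 1 and
  K the outward step leaves the strip.\<close>

definition inside :: "int \<Rightarrow> int \<Rightarrow> 'a" where
  "inside K b = (if 2 \<le> b \<and> b \<le> K - 1 then 1 else 0)"

text \<open>In the lower half this is \<open>ferm_rec\<close>, or \<open>ferm_1\<close> at the wall;
  the upper half follows by reflection, which exchanges the two neighbours.\<close>

lemma ferm_height_rec: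
  assumes k: "k \<ge> 1" and b: "1 \<le> b" "b \<le> 2 * int k" and L: "L \<ge> 1"
  shows "ferm_height k b L N =
    q ^ N * (ferm_height k (b - 1) (L - 1) N + ferm_height k (b + 1) (L - 1) N)
    - inside (2 * int k) b * (q ^ (2 * N) * ferm_height k b (L - 2) N
       - (if N = 0 then 0 else q ^ (2 * N - 1) * ferm_height k b (L - 2) (N - 1)))"
proof -
  have low: "ferm_height k (int j) L N =
    q ^ N * (ferm_height k (int j - 1) (L - 1) N + ferm_height k (int j + 1) (L - 1) N)
    - inside (2 * int k) (int j) * (q ^ (2 * N) * ferm_height k (int j) (L - 2) N
       - (if N = 0 then 0 else q ^ (2 * N - 1) * ferm_height k (int j) (L - 2) (N - 1)))"
    if j: "1 \<le> j" "j \<le> k" for j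
  proof (cases "j = 1")
    case True
    have "ferm_height k (int j - 1) (L - 1) N = 0" using True by (simp add: ferm_height_def)
    moreover have "ferm_height k (int j + 1) (L - 1) N = ferm (k - 1) 2 (L - 1) N"
      using ferm_height_low[of 2 k] True k by simp
    moreover have "ferm_height k (int j) L N = ferm (k - 1) 1 L N"
      using ferm_height_low[of 1 k] True k by simp
    ultimately show ?thesis using ferm_1[OF L] True by (simp add: inside_def)
  next
    case False
    have "ferm_height k (int j - 1) (L - 1) N = ferm (k - 1) (j - 1) (L - 1) N"
      using ferm_height_low[of "j - 1" k] j False k by (simp add: of_nat_diff)
    moreover have "ferm_height k (int j + 1) (L - 1) N = ferm (k - 1) (j + 1) (L - 1) N"
      using ferm_height_low[of "j + 1" k] j k by (simp add: add.commute)
    moreover have "ferm_height k (int j) M n = ferm (k - 1) j M n" for M n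
      using ferm_height_low[of j k] j k by simp
    moreover have "inside (2 * int k) (int j) = 1"
      using j False k by (simp add: inside_def)
    ultimately show ?thesis
      using ferm_rec[of j "k - 1" L N] j False k L by (simp add: add.commute)
  qed
  show ?thesis
  proof (cases "b \<le> int k")
    case True
    then show ?thesis using low[of "nat b"] b by simp
  next
    case False
    define c where "c = 2 * int k + 1 - b"
    have c: "1 \<le> c" "c \<le> int k" using False b by (auto simp: c_def)
    have "inside (2 * int k) b = inside (2 * int k) c" by (auto simp: inside_def c_def)
    moreover have "ferm_height k b M n = ferm_height k c M n" for M n
      unfolding c_def by (simp add: ferm_height_reflect)
    moreover have "ferm_height k (b + 1) M n = ferm_height k (c - 1) M n" for M n
      using ferm_height_reflect[of k "b + 1"] by (simp add: c_def algebra_simps)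
    moreover have "ferm_height k (b - 1) M n = ferm_height k (c + 1) M n" for M n
      using ferm_height_reflect[of k "b - 1"] by (simp add: c_def algebra_simps)
    ultimately show ?thesis using low[of "nat c"] c by (simp add: add.commute)
  qed
qed

text \<open>The cut at x = 0 leaves whole paths from i; the cut at x = L leaves final parts of
  length 0, which exist only at the end heights k and k + 1.\<close>

lemma sum_ferm_eq_bose:
  assumes i: "1 \<le> i" "i \<le> k" and B: "int L \<le> B"
  shows "(\<Sum>N\<le>L. ferm (k - 1) i (int L) N) =
    bose B (2 * int k + 1) (int i) L (int k) + bose B (2 * int k + 1) (int i) L (int k + 1)"
proof -
  define K where "K = 2 * int k"
  have K: "K \<ge> 2" using i by (simp add: K_def)
  \<comment> \<open>Cut off outside the strip, because \<open>bose\<close> need not vanish at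
    heights 0 and K + 1.\<close>
  define G where "G x b = (if 1 \<le> b \<and> b \<le> K then bose B (K + 1) (int i) x b else 0)" for x b
  \<comment> \<open>Positions in the final part are counted from the cut; the offset x gives a
    factor q^x for each of its N weighted extrema.\<close>
  define R where "R x b = (\<Sum>N\<le>L. q ^ (x * N) * ferm_height k b (int L - int x) N)" for x b
  have p: "0 < int i" "2 * int i < K + 1" using i by (auto simp: K_def)
  have "(\<Sum>b=1..K. G 0 b * R 0 b) = (\<Sum>b=1..K. G L b * R L b)"
  proof (rule pairing_constant[where \<chi> = "inside K"])
    show "G x 0 = 0" "G x (K + 1) = 0" for x by (simp_all add: G_def)
    show "R x 0 = 0" "R x (K + 1) = 0" for x
      by (simp_all add: R_def ferm_height_def K_def)
    show "R (Suc L) b = 0" for b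
      by (simp add: R_def ferm_height_eq_0)
    show "G (Suc x) b = G x (b - 1) + G x (b + 1) - inside K b * (1 - q ^ x) * G (x - 1) b"
      if x: "x < L" and b: "b \<in> {1..K}" for x b
    proof -
      have low: "bose B (K + 1) (int i) x 0 = (1 - q ^ x) * bose B (K + 1) (int i) (x - 1) 1"
      proof (cases "x = 0")
        case True
        then show ?thesis using bose_0[OF p, of 0 B] p K B by simp
      qed (use bose_lower[OF p] in auto)
      have high: "bose B (K + 1) (int i) x (K + 1) = (1 - q ^ x) * bose B (K + 1) (int i) (x - 1) K"
      proof (cases "x = 0")
        case True
        then show ?thesis using bose_0[OF p, of "K + 1" B] p K B by simp
      next
        case False
        then show ?thesis using bose_upper[OF p, of x B] x B by simp
      qed
      consider "b = 1" | "b = K" | "2 \<le> b" "b \<le> K - 1" using b by fastforce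
      then show ?thesis
      proof cases
        case 1
        then show ?thesis
          using bose_Suc[of B "K + 1" "int i" x b] low K by (simp add: G_def inside_def)
      next
        case 2
        then show ?thesis
          using bose_Suc[of B "K + 1" "int i" x b] high K by (simp add: G_def inside_def)
      next
        case 3
        then show ?thesis
          using bose_Suc[of B "K + 1" "int i" x b] by (simp add: G_def inside_def)
      qed
    qed
    show "R x b = R (Suc x) (b - 1) + R (Suc x) (b + 1)
        - inside K b * (1 - q ^ Suc x) * R (Suc (Suc x)) b"
      if x: "x < L" and b: "b \<in> {1..K}" for x b
    proof -
      define f where "f c N = ferm_height k c (int L - int (Suc x)) N" for c N
      define g where "g N = ferm_height k b (int L - int (Suc (Suc x))) N" for N
      have rec: "ferm_height k b (int L - int x) N = q ^ N * (f (b - 1) N + f (b + 1) N)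
          - inside K b * (q ^ (2 * N) * g N - (if N = 0 then 0 else q ^ (2 * N - 1) * g (N - 1)))" for N
        using ferm_height_rec[of k b "int L - int x" N] i b x
        by (simp add: f_def g_def K_def algebra_simps)
      \<comment> \<open>Putting N + 1 for N turns the exponent x N + 2N - 1 into (x + 1) + (x + 2)
        N; the term N = L on the right vanishes for lack of length.\<close>
      have shift: "(\<Sum>N\<le>L. q ^ (x * N) * (if N = 0 then 0 else q ^ (2 * N - 1) * g (N - 1)))
          = q ^ Suc x * (\<Sum>N\<le>L. q ^ (Suc (Suc x) * N) * g N)"
      proof (cases L)
        case 0
        then show ?thesis using x by simp
      next
        case (Suc M)
        have "g L = 0" by (simp add: g_def ferm_height_eq_0)
        then have "(\<Sum>N\<le>L. q ^ (Suc (Suc x) * N) * g N) = (\<Sum>N\<le>M. q ^ (Suc (Suc x) * N) * g N)"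
          using Suc by simp
        moreover have "x * Suc N + (2 * Suc N - 1) = Suc x + Suc (Suc x) * N" for N
          by (simp add: algebra_simps)
        then have "q ^ (x * Suc N) * q ^ (2 * Suc N - 1) = q ^ Suc x * q ^ (Suc (Suc x) * N)" for N
          by (metis power_add)
        ultimately show ?thesis
          unfolding Suc sum.atMost_Suc_shift
          by (simp add: sum_distrib_left flip: mult.assoc del: power_Suc mult_Suc mult_Suc_right)
      qed
      have "R x b = (\<Sum>N\<le>L. q ^ (Suc x * N) * f (b - 1) N + q ^ (Suc x * N) * f (b + 1) N
          - inside K b * (q ^ (Suc (Suc x) * N) * g N
          - q ^ (x * N) * (if N = 0 then 0 else q ^ (2 * N - 1) * g (N - 1))))"
        unfolding R_def rec
        by (intro sum.cong refl) (simp add: algebra_simps power_add mult_2 mult_2_right)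
      also have "\<dots> = R (Suc x) (b - 1) + R (Suc x) (b + 1)
        - inside K b * (1 - q ^ Suc x) * R (Suc (Suc x)) b"
        unfolding sum.distrib sum_subtractf sum_distrib_left[symmetric] shift
        by (simp add: R_def f_def g_def algebra_simps)
      finally show ?thesis .
    qed
  qed
  moreover have "(\<Sum>b=1..K. G 0 b * R 0 b) = R 0 (int i)"
  proof -
    have "G 0 b = (if b = int i then 1 else 0)" if "b \<in> {1..K}" for b
      using bose_0[OF p, of b B] that B by (simp add: G_def)
    then have "(\<Sum>b=1..K. G 0 b * R 0 b) = (\<Sum>b=1..K. if b = int i then R 0 b else 0)"
      by (intro sum.cong) auto
    then show ?thesis using p by simp
  qed
  moreover have "R 0 (int i) = (\<Sum>N\<le>L. ferm (k - 1) i (int L) N)"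
    using i by (simp add: R_def ferm_height_low)
  moreover have "(\<Sum>b=1..K. G L b * R L b) = G L (int k) + G L (int k + 1)"
  proof -
    have R: "R L b = ferm_height k b 0 0" for b
    proof -
      have "R L b = (\<Sum>N\<in>{0}. q ^ (L * N) * ferm_height k b 0 N)"
        unfolding R_def by (intro sum.mono_neutral_cong_right) (auto simp: ferm_height_eq_0)
      then show ?thesis by simp
    qed
    \<comment> \<open>A path of length 0 must already be at its end, the top height j + 1 of the
      folded strip.\<close>
    have "ferm j h 0 0 = (if h = j + 1 then 1 else 0)" if "1 \<le> h" "h \<le> j + 1" for j h
      using that
    proof (induction j arbitrary: h)
      case (Suc j)
      show ?case
      proof (cases "h = 1")
        case True
        then show ?thesis by (simp add: ferm.simps(2) qbinom_eq_0)
      next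
        case False
        then obtain h' where "h = Suc h'" "h' \<ge> 1" using Suc.prems by (cases h) auto
        then show ?thesis using Suc by (simp add: ferm_Suc qbinom_0_right)
      qed
    qed auto
    then have ferm_0: "R L b = (if b = int k \<or> b = int k + 1 then 1 else 0)" if "b \<in> {1..K}" for b
      unfolding R ferm_height_def using that i by (auto simp: K_def nat_eq_iff min_def)
    have "(\<Sum>b=1..K. G L b * R L b) = (\<Sum>b\<in>{int k, int k + 1}. G L b * R L b)"
      using i by (intro sum.mono_neutral_right) (auto simp: K_def ferm_0)
    then show ?thesis using ferm_0 i by (simp add: K_def)
  qed
  ultimately show ?thesis using i by (simp add: G_def K_def)
qed

subsection \<open>From tuples to the recursion\<close>

text \<open>The length is an arbitrary integer L rather than an even number because
  \<open>inner_weight_1\<close> changes its parity.\<close>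

definition inner_weight :: "nat \<Rightarrow> nat \<Rightarrow> int \<Rightarrow> (nat \<Rightarrow> int) \<Rightarrow> 'a" where
  "inner_weight k i L \<nu> =
     q powi ((\<Sum>j=1..<k. (\<nu> j)\<^sup>2) + (\<Sum>j=i..<k. \<nu> j))
     * (\<Prod>j=1..<k. qbinom q (L - 2 * (\<Sum>l=1..<j. \<nu> l) - \<nu> j - \<nu> (j + 1) - alpha i j)
          (\<nu> j - \<nu> (j + 1)))"

text \<open>\<open>alpha (Suc i)\<close> vanishes at the first index and is a shift of
  \<open>alpha i\<close> afterwards; v enters every later partial sum and so lowers the length by
  2v.\<close>

lemma inner_weight_cons:
  assumes "\<mu> \<in> inner_tuples k" "k \<ge> 1" "\<mu> 1 \<le> v" "i \<ge> 1"
  shows "inner_weight (Suc k) (Suc i) L (tuple_cons k v \<mu>) =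
    q powi v\<^sup>2 * (qbinom q (L - v - \<mu> 1) (v - \<mu> 1) * inner_weight k i (L - 2 * v) \<mu>)"
proof -
  obtain k' where k: "k = Suc k'" using assms by (cases k) auto
  let ?\<nu> = "tuple_cons k v \<mu>"
  have \<nu>: "?\<nu> 1 = v" "?\<nu> (Suc 0) = v" "1 \<le> j \<Longrightarrow> j \<le> k \<Longrightarrow> ?\<nu> (Suc j) = \<mu> j" for j
    by (auto simp: tuple_cons_def)
  have pos: "\<mu> j \<ge> 0" if "1 \<le> j" "j \<le> k" for j
    using assms that by (auto simp: inner_tuples_iff)
  have "(\<Sum>j=1..<Suc k. (?\<nu> j)\<^sup>2) = v\<^sup>2 + (\<Sum>j=1..<k. (\<mu> j)\<^sup>2)"
    unfolding k sum_lessThan_split_first using \<nu> by (simp add: k)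
  moreover have "(\<Sum>j=Suc i..<Suc k. ?\<nu> j) = (\<Sum>j=i..<k. \<mu> j)"
    unfolding sum.shift_bounds_Suc_ivl using \<nu> assms by (intro sum.cong) auto
  moreover have "(\<Sum>j=1..<k. (\<mu> j)\<^sup>2) \<ge> 0" by (intro sum_nonneg) auto
  moreover have "(\<Sum>j=i..<k. \<mu> j) \<ge> 0" using assms by (intro sum_nonneg pos) auto
  ultimately have 1: "q powi ((\<Sum>j=1..<Suc k. (?\<nu> j)\<^sup>2) + (\<Sum>j=Suc i..<Suc k. ?\<nu> j))
      = q powi v\<^sup>2 * q powi ((\<Sum>j=1..<k. (\<mu> j)\<^sup>2) + (\<Sum>j=i..<k. \<mu> j))"
    by (simp add: power_int_add_nonneg add.assoc flip: power_int_add_nonneg)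
  have 2: "qbinom q (L - 2 * (\<Sum>l=1..<Suc j. ?\<nu> l) - ?\<nu> (Suc j) - ?\<nu> (Suc j + 1) - alpha (Suc i) (Suc j))
          (?\<nu> (Suc j) - ?\<nu> (Suc j + 1)) =
        qbinom q (L - 2 * v - 2 * (\<Sum>l=1..<j. \<mu> l) - \<mu> j - \<mu> (j + 1) - alpha i j) (\<mu> j - \<mu> (j + 1))"
    if jk: "1 \<le> j" "j < k" for j
  proof -
    obtain j' where j: "j = Suc j'" using jk by (cases j) auto
    have "(\<Sum>l=1..<Suc j. ?\<nu> l) = v + (\<Sum>l=1..<j. \<mu> l)"
      unfolding j sum_lessThan_split_first using \<nu> jk by (simp add: j)
    moreover have "alpha (Suc i) (Suc j) = alpha i j" by (simp add: alpha_def)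
    ultimately show ?thesis using \<nu>(3)[of j] \<nu>(3)[of "j + 1"] jk by (simp add: algebra_simps)
  qed
  have "(\<Prod>j=1..<Suc k. qbinom q (L - 2 * (\<Sum>l=1..<j. ?\<nu> l) - ?\<nu> j - ?\<nu> (j + 1) - alpha (Suc i) j)
          (?\<nu> j - ?\<nu> (j + 1)))
     = qbinom q (L - v - \<mu> 1) (v - \<mu> 1) *
      (\<Prod>j=1..<k. qbinom q (L - 2 * v - 2 * (\<Sum>l=1..<j. \<mu> l) - \<mu> j - \<mu> (j + 1) - alpha i j)
          (\<mu> j - \<mu> (j + 1)))"
    unfolding k prod_lessThan_split_first
  proof (intro arg_cong2[where f = "(*)"] prod.cong refl)
    show "qbinom q (L - 2 * sum (tuple_cons (Suc k') v \<mu>) {1..<1} - tuple_cons (Suc k') v \<mu> 1 -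
        tuple_cons (Suc k') v \<mu> (1 + 1) - alpha (Suc i) 1)
      (tuple_cons (Suc k') v \<mu> 1 - tuple_cons (Suc k') v \<mu> (1 + 1)) = qbinom q (L - v - \<mu> 1) (v - \<mu> 1)"
      using assms by (simp add: tuple_cons_def alpha_def)
  qed (use 2 k in auto)
  then show ?thesis unfolding inner_weight_def 1 by (simp add: mult_ac)
qed

text \<open>Passing from i = 2 to i = 1 raises \<open>alpha\<close> by one at every index, which
  lowers the length by one; the linear exponent gains \<open>\<nu> 1\<close>.\<close>

lemma inner_weight_1:
  assumes "\<nu> \<in> inner_tuples k" "k \<ge> 2"
  shows "inner_weight k 1 L \<nu> = q powi (\<nu> 1) * inner_weight k 2 (L - 1) \<nu>"
proof -
  have pos: "\<nu> j \<ge> 0" if "1 \<le> j" "j \<le> k" for j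
    using assms that by (auto simp: inner_tuples_iff)
  have "(\<Sum>j=1..<k. \<nu> j) = \<nu> 1 + (\<Sum>j=2..<k. \<nu> j)"
    using assms by (subst sum.atLeast_Suc_lessThan) (auto simp: numeral_2_eq_2)
  moreover have "(\<Sum>j=1..<k. (\<nu> j)\<^sup>2) \<ge> 0" by (intro sum_nonneg) auto
  moreover have "(\<Sum>j=2..<k. \<nu> j) \<ge> 0" by (intro sum_nonneg pos) auto
  ultimately have 1: "q powi ((\<Sum>j=1..<k. (\<nu> j)\<^sup>2) + (\<Sum>j=1..<k. \<nu> j))
      = q powi (\<nu> 1) * q powi ((\<Sum>j=1..<k. (\<nu> j)\<^sup>2) + (\<Sum>j=2..<k. \<nu> j))"
    using pos[of 1] assms by (simp add: power_int_add_nonneg[symmetric] algebra_simps)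
  have "alpha 1 j = alpha 2 j + 1" if "j \<ge> 1" for j
    using that by (auto simp: alpha_def)
  then have "(\<Prod>j=1..<k. qbinom q (L - 2 * (\<Sum>l=1..<j. \<nu> l) - \<nu> j - \<nu> (j + 1) - alpha 1 j)
          (\<nu> j - \<nu> (j + 1)))
     = (\<Prod>j=1..<k. qbinom q (L - 1 - 2 * (\<Sum>l=1..<j. \<nu> l) - \<nu> j - \<nu> (j + 1) - alpha 2 j)
          (\<nu> j - \<nu> (j + 1)))"
    by (intro prod.cong refl) (auto simp: algebra_simps)
  then show ?thesis unfolding inner_weight_def 1 by (simp add: mult_ac)
qed

text \<open>The induction follows the recursion of \<open>ferm\<close>. The condition on L reflects
  the case k = 0, where the empty product is 1 but \<open>ferm 0\<close> is cut off at negative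
  lengths.\<close>

lemma sum_inner_weight_head:
  assumes "1 \<le> i" "i \<le> Suc k" "k = 0 \<Longrightarrow> L \<ge> 0"
  shows "(\<Sum>\<nu> | \<nu> \<in> inner_tuples (Suc k) \<and> \<nu> 1 = int N. inner_weight (Suc k) i L \<nu>) = ferm k i L N"
  using assms
proof (induction k arbitrary: i L N)
  case 0
  define \<nu>0 :: "nat \<Rightarrow> int" where "\<nu>0 j = (if j = 1 then 0 else undefined)" for j
  have "{\<nu>. \<nu> \<in> inner_tuples (Suc 0) \<and> \<nu> 1 = int N} = (if N = 0 then {\<nu>0} else {})"
    by (auto simp: inner_tuples_iff \<nu>0_def fun_eq_iff)
  then show ?case using 0 by (auto simp: inner_weight_def)
next
  case (Suc k)
  have step: "(\<Sum>\<nu> | \<nu> \<in> inner_tuples (Suc (Suc k)) \<and> \<nu> 1 = int N. inner_weight (Suc (Suc k)) (Suc h) M \<nu>)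
      = ferm (Suc k) (Suc h) M N" if h: "1 \<le> h" "h \<le> Suc k" for h M
  proof -
    define S where "S n = {\<mu>. \<mu> \<in> inner_tuples (Suc k) \<and> \<mu> 1 = int n}" for n
    have fin: "finite (S n)" for n
      by (rule finite_subset[OF _ finite_inner_tuples_head[of "Suc k" "int n"]]) (auto simp: S_def)
    have "(\<Sum>\<nu> | \<nu> \<in> inner_tuples (Suc (Suc k)) \<and> \<nu> 1 = int N. inner_weight (Suc (Suc k)) (Suc h) M \<nu>)
      = (\<Sum>(n, \<mu>)\<in>Sigma {..N} S. q ^ N\<^sup>2 * (qbinom q (M - int N - int n) (int N - int n)
           * inner_weight (Suc k) h (M - 2 * int N) \<mu>))"
    proof (rule sum.reindex_bij_witness[of _ "\<lambda>(n, \<mu>). tuple_cons (Suc k) (int N) \<mu>"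
          "\<lambda>\<nu>. (nat (\<nu> 2), tuple_tail (Suc k) \<nu>)"])
      fix \<nu> assume "\<nu> \<in> {\<nu>. \<nu> \<in> inner_tuples (Suc (Suc k)) \<and> \<nu> 1 = int N}"
      then have \<nu>: "\<nu> \<in> inner_tuples (Suc (Suc k))" "\<nu> 1 = int N" by auto
      have \<nu>2: "0 \<le> \<nu> 2" "\<nu> 2 \<le> \<nu> 1"
        using \<nu> unfolding inner_tuples_iff by (auto simp: numeral_2_eq_2)
      have t1: "tuple_tail (Suc k) \<nu> 1 = \<nu> 2"
        by (simp add: tuple_tail_def numeral_2_eq_2)
      have t: "tuple_tail (Suc k) \<nu> \<in> inner_tuples (Suc k)"
        using \<nu> by (intro tuple_tail_in) auto
      show c: "(case (nat (\<nu> 2), tuple_tail (Suc k) \<nu>) of (n, \<mu>) \<Rightarrow> tuple_cons (Suc k) (int N) \<mu>) = \<nu>"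
        using tuple_cons_tail[OF \<nu>(1)] \<nu>(2) by simp
      show "(nat (\<nu> 2), tuple_tail (Suc k) \<nu>) \<in> Sigma {..N} S"
        using t t1 \<nu>2 \<nu>(2) by (auto simp: S_def)
      show "(case (nat (\<nu> 2), tuple_tail (Suc k) \<nu>) of (n, \<mu>) \<Rightarrow>
           q ^ N\<^sup>2 * (qbinom q (M - int N - int n) (int N - int n)
           * inner_weight (Suc k) h (M - 2 * int N) \<mu>)) = inner_weight (Suc (Suc k)) (Suc h) M \<nu>"
        using inner_weight_cons[OF t, of "int N" h M] c t1 \<nu>2 \<nu>(2) h
        by (simp flip: of_nat_power)
    next
      fix z assume "z \<in> Sigma {..N} S"
      then obtain n \<mu> where z: "z = (n, \<mu>)" "n \<le> N" "\<mu> \<in> inner_tuples (Suc k)" "\<mu> 1 = int n"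
        by (auto simp: S_def)
      have "tuple_cons (Suc k) (int N) \<mu> 2 = \<mu> 1" by (simp add: tuple_cons_def)
      then show "(nat ((case z of (n, \<mu>) \<Rightarrow> tuple_cons (Suc k) (int N) \<mu>) 2),
          tuple_tail (Suc k) (case z of (n, \<mu>) \<Rightarrow> tuple_cons (Suc k) (int N) \<mu>)) = z"
        using z by (simp add: tuple_tail_cons)
      show "(case z of (n, \<mu>) \<Rightarrow> tuple_cons (Suc k) (int N) \<mu>)
          \<in> {\<nu>. \<nu> \<in> inner_tuples (Suc (Suc k)) \<and> \<nu> 1 = int N}"
        using tuple_cons_in[OF z(3)] z by (simp add: tuple_cons_def)
    qed
    also have "\<dots> = (\<Sum>n\<le>N. \<Sum>\<mu>\<in>S n. q ^ N\<^sup>2 * (qbinom q (M - int N - int n) (int N - int n)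
           * inner_weight (Suc k) h (M - 2 * int N) \<mu>))"
      using fin by (intro sum.Sigma[symmetric]) auto
    also have "\<dots> = (\<Sum>n\<le>N. q ^ N\<^sup>2 * (qbinom q (M - int N - int n) (int N - int n)
           * ferm k h (M - 2 * int N) n))"
    proof (intro sum.cong refl)
      fix n
      show "(\<Sum>\<mu>\<in>S n. q ^ N\<^sup>2 * (qbinom q (M - int N - int n) (int N - int n)
           * inner_weight (Suc k) h (M - 2 * int N) \<mu>)) = q ^ N\<^sup>2 * (qbinom q (M - int N - int n) (int N - int n)
           * ferm k h (M - 2 * int N) n)"
      proof (cases "M - 2 * int N < 0")
        case True
        then show ?thesis by (simp add: qbinom_eq_0)
      next
        case False
        then show ?thesis
          unfolding S_def sum_distrib_left[symmetric] using Suc.IH[of h "M - 2 * int N" n] h by simp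
      qed
    qed
    finally show ?thesis using h by (simp add: ferm_Suc sum_distrib_left)
  qed
  show ?case
  proof (cases "i = 1")
    case True
    have "(\<Sum>\<nu> | \<nu> \<in> inner_tuples (Suc (Suc k)) \<and> \<nu> 1 = int N. inner_weight (Suc (Suc k)) i L \<nu>)
      = (\<Sum>\<nu> | \<nu> \<in> inner_tuples (Suc (Suc k)) \<and> \<nu> 1 = int N.
           q ^ N * inner_weight (Suc (Suc k)) (Suc 1) (L - 1) \<nu>)"
      using inner_weight_1[of _ "Suc (Suc k)" L] True
      by (intro sum.cong refl) (auto simp: numeral_2_eq_2)
    also have "\<dots> = q ^ N * ferm (Suc k) (Suc 1) (L - 1) N"
      unfolding sum_distrib_left[symmetric] by (subst step) auto
    also have "\<dots> = ferm (Suc k) i L N"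
      using ferm_Suc_1[of k L N] True by (simp add: numeral_2_eq_2)
    finally show ?thesis .
  next
    case False
    then obtain h where "i = Suc h" "h \<ge> 1" using Suc.prems by (cases i) auto
    then show ?thesis using step[of h L] Suc.prems by simp
  qed
qed

text \<open>If \<open>\<nu> 1 > L\<close>, the first q-binomial vanishes (for k = 1 no such tuple
  exists); the other tuples are grouped by \<open>\<nu> 1\<close>.\<close>

lemma inner_sum_eq_ferm:
  assumes "1 \<le> i" "i \<le> k"
  shows "sum_supp (inner_tuples k) (inner_weight k i (int L)) = (\<Sum>N\<le>L. ferm (k - 1) i (int L) N)"
proof -
  define S where "S = {\<nu> \<in> inner_tuples k. \<nu> 1 \<le> int L}"
  have k: "k \<ge> 1" "Suc (k - 1) = k" using assms by auto
  have fin: "finite S" unfolding S_def using k by (intro finite_inner_tuples_head)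
  have pos: "\<nu> 1 \<ge> 0" if "\<nu> \<in> inner_tuples k" for \<nu>
    using that k unfolding inner_tuples_iff by auto
  have "sum_supp (inner_tuples k) (inner_weight k i (int L)) = sum (inner_weight k i (int L)) S"
  proof (rule sum_supp_eq_sum[OF fin])
    fix \<nu> assume \<nu>: "\<nu> \<in> inner_tuples k" "\<nu> \<notin> S"
    then have gt: "\<nu> 1 > int L" by (simp add: S_def)
    have "k \<noteq> 1" using \<nu>(1) gt by (auto simp: inner_tuples_iff)
    then have k2: "k \<ge> 2" using k by simp
    have "\<nu> 2 \<ge> 0" "alpha i 1 \<ge> 0"
      using \<nu>(1) k2 by (auto simp: inner_tuples_iff alpha_def)
    then have "qbinom q (int L - 2 * (\<Sum>l=1..<1. \<nu> l) - \<nu> 1 - \<nu> (1 + 1) - alpha i 1) (\<nu> 1 - \<nu> (1 + 1)) = 0"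
      using gt by (intro qbinom_eq_0) (auto simp: one_add_one)
    then have "(\<Prod>j=1..<k. qbinom q (int L - 2 * (\<Sum>l=1..<j. \<nu> l) - \<nu> j - \<nu> (j + 1) - alpha i j)
        (\<nu> j - \<nu> (j + 1))) = 0"
      using k2 by (intro prod_zero bexI[of _ 1]) auto
    then show "inner_weight k i (int L) \<nu> = 0" by (simp add: inner_weight_def)
  qed (auto simp: S_def)
  also have "\<dots> = (\<Sum>N\<le>L. \<Sum>\<nu> | \<nu> \<in> S \<and> nat (\<nu> 1) = N. inner_weight k i (int L) \<nu>)"
    using fin by (intro sum.group[symmetric]) (auto simp: S_def)
  also have "\<dots> = (\<Sum>N\<le>L. ferm (k - 1) i (int L) N)"
  proof (intro sum.cong refl)
    fix N assume "N \<in> {..L}"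
    then have "{\<nu>. \<nu> \<in> S \<and> nat (\<nu> 1) = N} = {\<nu>. \<nu> \<in> inner_tuples k \<and> \<nu> 1 = int N}"
      using pos by (auto simp: S_def nat_eq_iff)
    then show "(\<Sum>\<nu> | \<nu> \<in> S \<and> nat (\<nu> 1) = N. inner_weight k i (int L) \<nu>) = ferm (k - 1) i (int L) N"
      using sum_inner_weight_head[of i "k - 1" "int L" N] k assms by simp
  qed
  finally show ?thesis .
qed

subsection \<open>Bailey's lemma\<close>

text \<open>Exactly one of D and D + 1 is even, and only that term survives; this choice produces
  the floor in the theorem.\<close>

lemma qpaths_pair:
  "qpaths (2 * M) D + qpaths (2 * M) (D + 1) = qbinom q (2 * int M) (int M - (- D) div 2)"
proof -
  define d where "d = (- D) div 2"
  have sym: "qbinom q (2 * int M) (int M + d) = qbinom q (2 * int M) (int M - d)"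
    using qbinom_symmetric[of "2 * int M" "int M - d"] by (simp add: algebra_simps)
  show ?thesis
  proof (cases "even D")
    case True
    then have "D = - 2 * d" by (auto simp: d_def)
    then show ?thesis unfolding d_def[symmetric] using sym by (simp add: qpaths_def add.commute)
  next
    case False
    then have "D = - 2 * d - 1" unfolding d_def by presburger
    then show ?thesis unfolding d_def[symmetric] using sym by (simp add: qpaths_def add.commute)
  qed
qed

text \<open>Even r = 2s gives the direct images, odd r = -2s - 1 the mirror images with sign -1. The
  asymmetric range of r is what s in -B..B produces.\<close>

lemma bose_sum_eq:
  fixes k i M :: nat and B :: int
  assumes "1 \<le> i" "i \<le> k" "B \<ge> 0"
  defines "p \<equiv> 2 * int k + 1"
  shows "bose B p (int i) (2 * M) (int k) + bose B p (int i) (2 * M) (int k + 1)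
    = (\<Sum>r=-2*B-1..2*B. (-1) powi r * q powi (r * (p * r + 2 * int k - 2 * int i + 1) div 2)
         * qbinom q (2 * int M) (int M - (int i - int k - p * r) div 2))"
    (is "_ = (\<Sum>r=_.._. ?f r)")
proof -
  have pi: "0 < int i" "2 * int i < p" using assms by auto
  have even: "?f (2 * s) = q ^ nat (s * (2 * s * p + p - 2 * int i))
      * (qpaths (2 * M) (int k - int i + 2 * p * s) + qpaths (2 * M) (int k + 1 - int i + 2 * p * s))" for s
  proof -
    have e: "2 * s * (p * (2 * s) + 2 * int k - 2 * int i + 1) div 2 = s * (2 * s * p + p - 2 * int i)"
      by (simp add: p_def algebra_simps)
    have "qpaths (2 * M) (int k - int i + 2 * p * s) + qpaths (2 * M) (int k + 1 - int i + 2 * p * s)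
      = qbinom q (2 * int M) (int M - (int i - int k - p * (2 * s)) div 2)"
      using qpaths_pair[of M "int k - int i + 2 * p * s"] by (simp add: algebra_simps)
    moreover have "(-1 :: 'a) powi (2 * s) = 1"
      by (simp add: power_int_minus_left)
    moreover have "q powi (s * (2 * s * p + p - 2 * int i)) = q ^ nat (s * (2 * s * p + p - 2 * int i))"
      using bose_exponents_nonneg(1)[OF pi, of s] by (simp only: power_int_def if_True)
    ultimately show ?thesis
      unfolding e by simp
  qed
  have odd: "?f (- 2 * s - 1) = - (q ^ nat ((2 * s + 1) * (s * p + int i))
      * (qpaths (2 * M) (int k + int i + 2 * p * s) + qpaths (2 * M) (int k + 1 + int i + 2 * p * s)))" for s
  proof -
    have e: "(- 2 * s - 1) * (p * (- 2 * s - 1) + 2 * int k - 2 * int i + 1) div 2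
        = (2 * s + 1) * (s * p + int i)"
      by (simp add: p_def algebra_simps)
    define D where "D = int k + int i + 2 * p * s"
    have d: "(int i - int k - p * (- 2 * s - 1)) div 2 = - ((- D) div 2)"
    proof -
      have "int i - int k - p * (- 2 * s - 1) = D + 1"
        by (simp add: D_def p_def algebra_simps)
      moreover have "(D + 1) div 2 = - ((- D) div 2)" by presburger
      ultimately show ?thesis by simp
    qed
    have "qpaths (2 * M) D + qpaths (2 * M) (D + 1) = qbinom q (2 * int M) (int M + (- D) div 2)"
      using qpaths_pair[of M D] qbinom_symmetric[of "2 * int M" "int M + (- D) div 2"]
      by (simp add: algebra_simps)
    then have "qpaths (2 * M) (int k + int i + 2 * p * s) + qpaths (2 * M) (int k + 1 + int i + 2 * p * s)
      = qbinom q (2 * int M) (int M - (int i - int k - p * (- 2 * s - 1)) div 2)"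
      unfolding d by (simp add: D_def algebra_simps)
    moreover have "(-1 :: 'a) powi (- 2 * s - 1) = -1"
      by (simp add: power_int_minus_left)
    moreover have "q powi ((2 * s + 1) * (s * p + int i)) = q ^ nat ((2 * s + 1) * (s * p + int i))"
      using bose_exponents_nonneg(2)[OF pi, of s] by (simp only: power_int_def if_True)
    ultimately show ?thesis
      unfolding e by simp
  qed
  have "(\<Sum>r=-2*B-1..2*B. ?f r) = (\<Sum>r\<in>{r. r \<in> {-2*B-1..2*B} \<and> even r}. ?f r)
      + (\<Sum>r\<in>{r. r \<in> {-2*B-1..2*B} \<and> odd r}. ?f r)"
  proof (subst sum.union_disjoint[symmetric])
    show "finite {r. r \<in> {-2*B-1..2*B} \<and> even r}" "finite {r. r \<in> {-2*B-1..2*B} \<and> odd r}"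
      by (rule finite_subset[of _ "{-2*B-1..2*B}"], auto)+
  qed (auto intro!: sum.cong)
  also have "(\<Sum>r\<in>{r. r \<in> {-2*B-1..2*B} \<and> even r}. ?f r) = (\<Sum>s=-B..B. ?f (2 * s))"
    by (rule sum.reindex_bij_witness[of _ "\<lambda>s. 2 * s" "\<lambda>r. r div 2"]) auto
  also have "(\<Sum>r\<in>{r. r \<in> {-2*B-1..2*B} \<and> odd r}. ?f r) = (\<Sum>s=-B..B. ?f (- 2 * s - 1))"
  proof (rule sum.reindex_bij_witness[of _ "\<lambda>s. - 2 * s - 1" "\<lambda>r. (- r) div 2"])
    fix r assume r: "r \<in> {r. r \<in> {-2*B-1..2*B} \<and> odd r}"
    show *: "- 2 * ((- r) div 2) - 1 = r" using r by simp presburger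
    show "(- r) div 2 \<in> {- B..B}" using r by auto
    show "?f (- 2 * ((- r) div 2) - 1) = ?f r" unfolding * ..
  next
    fix s assume s: "s \<in> {-B..B}"
    show "- (- 2 * s - 1) div 2 = s" by simp
    show "- 2 * s - 1 \<in> {r. r \<in> {-2*B-1..2*B} \<and> odd r}" using s by simp
  qed
  finally show ?thesis
    unfolding even odd bose_def sum_negf distrib_left[of "q ^ e" for e] sum.distrib
    by (simp add: algebra_simps)
qed

text \<open>The \<open>M \<rightarrow> \<infinity>\<close> case of the \<open>q\<close>-Chu--Vandermonde sum.\<close>

lemma q_vandermonde_limit:
  "(\<Sum>j\<le>N. q ^ (j * (j + c)) * qbinom q (int N) (int j) / qpoch q q (j + c)) = 1 / qpoch q q (N + c)"
proof (induction N arbitrary: c)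
  case 0
  then show ?case by (simp add: qbinom_def)
next
  case (Suc N)
  \<comment> \<open>The mirrored Pascal rule puts the power of q on the term with j - 1, which
    becomes the case c + 1 of the induction hypothesis.\<close>
  have pascal: "qbinom q (int (Suc N)) (int j) =
      qbinom q (int N) (int j) + q ^ (Suc N - j) * qbinom q (int N) (int j - 1)" if "j \<le> Suc N" for j
  proof -
    have "nat (int (Suc N) - int j) = Suc N - j" using that by simp
    moreover have "qbinom q (int N) (int (Suc N) - int j - 1) = qbinom q (int N) (int j)"
      using qbinom_symmetric[of "int N" "int j"] by simp
    moreover have "qbinom q (int N) (int (Suc N) - int j) = qbinom q (int N) (int j - 1)"
      using qbinom_symmetric[of "int N" "int j - 1"] by (simp add: algebra_simps)
    ultimately show ?thesis
      using qbinom_pascal[of "int (Suc N)" "int (Suc N) - int j"] qbinom_symmetric[of "int (Suc N)" "int j"]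
      by simp
  qed
  have "(\<Sum>j\<le>Suc N. q ^ (j * (j + c)) * qbinom q (int (Suc N)) (int j) / qpoch q q (j + c))
    = (\<Sum>j\<le>Suc N. q ^ (j * (j + c)) * qbinom q (int N) (int j) / qpoch q q (j + c))
    + (\<Sum>j\<le>Suc N. q ^ (j * (j + c) + (Suc N - j)) * qbinom q (int N) (int j - 1) / qpoch q q (j + c))"
    unfolding sum.distrib[symmetric]
    by (intro sum.cong refl)
      (simp only: pascal atMost_iff power_add add_divide_distrib distrib_left mult.assoc)
  also have "(\<Sum>j\<le>Suc N. q ^ (j * (j + c)) * qbinom q (int N) (int j) / qpoch q q (j + c))
      = 1 / qpoch q q (N + c)"
    using Suc.IH[of c] by (simp add: qbinom_eq_0)
  also have "(\<Sum>j\<le>Suc N. q ^ (j * (j + c) + (Suc N - j)) * qbinom q (int N) (int j - 1) / qpoch q q (j + c))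
      = (\<Sum>j\<le>N. q ^ (Suc j * (Suc j + c) + (N - j)) * qbinom q (int N) (int j) / qpoch q q (j + Suc c))"
    unfolding sum.atMost_Suc_shift by (simp add: qbinom_eq_0)
  also have "\<dots> = (\<Sum>j\<le>N. q ^ Suc (N + c) * (q ^ (j * (j + Suc c)) * qbinom q (int N) (int j) / qpoch q q (j + Suc c)))"
  proof (intro sum.cong refl)
    fix j assume "j \<in> {..N}"
    then have "Suc j * (Suc j + c) + (N - j) = Suc (N + c) + j * (j + Suc c)"
      by (simp add: algebra_simps)
    then have "q ^ (Suc j * (Suc j + c) + (N - j)) = q ^ Suc (N + c) * q ^ (j * (j + Suc c))"
      by (simp only: power_add)
    then show "q ^ (Suc j * (Suc j + c) + (N - j)) * qbinom q (int N) (int j) / qpoch q q (j + Suc c)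
      = q ^ Suc (N + c) * (q ^ (j * (j + Suc c)) * qbinom q (int N) (int j) / qpoch q q (j + Suc c))"
      by (simp only: mult.assoc times_divide_eq_right)
  qed
  also have "\<dots> = q ^ Suc (N + c) / qpoch q q (Suc (N + c))"
    unfolding sum_distrib_left[symmetric] Suc.IH by simp
  also have "1 / qpoch q q (N + c) + \<dots> = 1 / qpoch q q (Suc N + c)"
    using power_neq_1[of "Suc (N + c)"] by (simp add: qpoch_Suc field_simps)
  finally show ?case .
qed

lemma inv_qfact_nat: "inv_qfact q (int m) = 1 / qpoch q q m"
  by (simp add: inv_qfact_def)

lemma inv_qfact_neg: "m < 0 \<Longrightarrow> inv_qfact q m = 0"
  by (simp add: inv_qfact_def)

text \<open>One step of Bailey's lemma at a = 1. For r >= 0 the shift m = r + j gives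
  \<open>q_vandermonde_limit\<close> with N = n - r and c = 2r; changing the sign of r only
  exchanges two factors.\<close>

lemma bailey_kernel:
  fixes n :: nat and r :: int
  shows "(\<Sum>m\<le>n. q ^ m\<^sup>2 * inv_qfact q (int n - int m) * (inv_qfact q (int m - r) * inv_qfact q (int m + r)))
    = q powi r\<^sup>2 * (inv_qfact q (int n - r) * inv_qfact q (int n + r))"
proof -
  have nonneg: "(\<Sum>m\<le>n. q ^ m\<^sup>2 * inv_qfact q (int n - int m) * (inv_qfact q (int m - int r) * inv_qfact q (int m + int r)))
    = q ^ r\<^sup>2 * (inv_qfact q (int n - int r) * inv_qfact q (int n + int r))" for r
  proof (cases "r \<le> n")
    case False
    then show ?thesis by (simp add: inv_qfact_neg)
  next
    case True
    define N where "N = n - r"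
    have n: "n = r + N" using True by (simp add: N_def)
    have "(\<Sum>m\<le>n. q ^ m\<^sup>2 * inv_qfact q (int n - int m) * (inv_qfact q (int m - int r) * inv_qfact q (int m + int r)))
      = (\<Sum>m\<in>{r..n}. q ^ m\<^sup>2 * inv_qfact q (int n - int m) * (inv_qfact q (int m - int r) * inv_qfact q (int m + int r)))"
      by (intro sum.mono_neutral_right) (auto simp: inv_qfact_neg)
    also have "\<dots> = (\<Sum>j\<le>N. q ^ r\<^sup>2 / qpoch q q N *
        (q ^ (j * (j + 2 * r)) * qbinom q (int N) (int j) / qpoch q q (j + 2 * r)))"
    proof (rule sum.reindex_bij_witness[of _ "\<lambda>j. r + j" "\<lambda>m. m - r"])
      fix m assume "m \<in> {r..n}"
      define j where "j = m - r"
      have m: "m = r + j" "j \<le> N" using \<open>m \<in> {r..n}\<close> by (auto simp: j_def N_def)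
      have "m\<^sup>2 = r\<^sup>2 + j * (j + 2 * r)" by (simp add: m power2_eq_square algebra_simps)
      then have "q ^ m\<^sup>2 = q ^ r\<^sup>2 * q ^ (j * (j + 2 * r))" by (simp only: power_add)
      moreover have "int n - int m = int (N - j)" "int m - int r = int j" "int m + int r = int (j + 2 * r)"
        using m n by (auto simp: of_nat_diff)
      moreover have "qbinom q (int N) (int j) = qpoch q q N / (qpoch q q j * qpoch q q (N - j))"
        using qbinom_nat[of j "N - j"] m by simp
      ultimately show "q ^ r\<^sup>2 / qpoch q q N *
        (q ^ ((m - r) * (m - r + 2 * r)) * qbinom q (int N) (int (m - r)) / qpoch q q (m - r + 2 * r))
        = q ^ m\<^sup>2 * inv_qfact q (int n - int m) * (inv_qfact q (int m - int r) * inv_qfact q (int m + int r))"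
        unfolding j_def[symmetric] by (simp only: inv_qfact_nat) (simp add: field_simps)
    qed (auto simp: n)
    also have "\<dots> = q ^ r\<^sup>2 * (1 / qpoch q q N * (1 / qpoch q q (N + 2 * r)))"
      unfolding sum_distrib_left[symmetric] q_vandermonde_limit by simp
    also have "\<dots> = q ^ r\<^sup>2 * (inv_qfact q (int N) * inv_qfact q (int (N + 2 * r)))"
      unfolding inv_qfact_nat ..
    also have "int N = int n - int r" by (simp add: n)
    also have "int (N + 2 * r) = int n + int r" by (simp add: n)
    finally show ?thesis .
  qed
  have sq: "q powi r\<^sup>2 = q ^ (nat \<bar>r\<bar>)\<^sup>2"
  proof -
    have "r\<^sup>2 = int ((nat \<bar>r\<bar>)\<^sup>2)" by simp
    then show ?thesis by (simp only: power_int_of_nat)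
  qed
  show ?thesis
  proof (cases "r \<ge> 0")
    case True
    then show ?thesis using nonneg[of "nat \<bar>r\<bar>"] unfolding sq by simp
  next
    case False
    then show ?thesis using nonneg[of "nat \<bar>r\<bar>"] unfolding sq by (simp add: mult.commute)
  qed
qed

fun bailey_chain :: "(nat \<Rightarrow> 'a) \<Rightarrow> nat \<Rightarrow> nat \<Rightarrow> 'a" where
  "bailey_chain H 0 n = H n"
| "bailey_chain H (Suc p) n = (\<Sum>m\<le>n. q ^ m\<^sup>2 * inv_qfact q (int n - int m) * bailey_chain H p m)"

text \<open>By \<open>bailey_kernel\<close> each step multiplies the coefficient of r by q to the
  power \<open>(f r)\<^sup>2\<close>. A hypothesis up to n suffices because a step never raises the
  index.\<close>

lemma bailey_chain_eq:
  assumes "\<And>m. m \<le> n \<Longrightarrow> H m = (\<Sum>r\<in>S. w r * (inv_qfact q (int m - f r) * inv_qfact q (int m + f r)))"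
    and "m \<le> n"
  shows "bailey_chain H p m =
    (\<Sum>r\<in>S. w r * q powi (int p * (f r)\<^sup>2) * (inv_qfact q (int m - f r) * inv_qfact q (int m + f r)))"
  using assms(2)
proof (induction p arbitrary: m)
  case 0
  then show ?case using assms(1) by simp
next
  case (Suc p)
  have "bailey_chain H (Suc p) m = (\<Sum>v\<le>m. \<Sum>r\<in>S. w r * q powi (int p * (f r)\<^sup>2) *
    (q ^ v\<^sup>2 * inv_qfact q (int m - int v) * (inv_qfact q (int v - f r) * inv_qfact q (int v + f r))))"
    using Suc by (simp add: sum_distrib_left mult_ac)
  also have "\<dots> = (\<Sum>r\<in>S. w r * q powi (int p * (f r)\<^sup>2) *
    (q powi (f r)\<^sup>2 * (inv_qfact q (int m - f r) * inv_qfact q (int m + f r))))"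
    by (subst sum.swap) (simp only: sum_distrib_left[symmetric] bailey_kernel)
  also have "\<dots> = (\<Sum>r\<in>S. w r * q powi (int (Suc p) * (f r)\<^sup>2) *
      (inv_qfact q (int m - f r) * inv_qfact q (int m + f r)))"
  proof (intro sum.cong refl)
    fix r
    have "int (Suc p) * (f r)\<^sup>2 = int p * (f r)\<^sup>2 + (f r)\<^sup>2" by (simp add: algebra_simps)
    then have "q powi (int (Suc p) * (f r)\<^sup>2) = q powi (int p * (f r)\<^sup>2) * q powi (f r)\<^sup>2"
      by (simp only: power_int_add_nonneg zero_le_power2 zero_le_mult_iff of_nat_0_le_iff simp_thms)
    then show "w r * q powi (int p * (f r)\<^sup>2) *
      (q powi (f r)\<^sup>2 * (inv_qfact q (int m - f r) * inv_qfact q (int m + f r))) =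
      w r * q powi (int (Suc p) * (f r)\<^sup>2) * (inv_qfact q (int m - f r) * inv_qfact q (int m + f r))"
      by (simp only: mult.assoc)
  qed
  finally show ?case .
qed

definition outer_weight :: "(nat \<Rightarrow> 'a) \<Rightarrow> nat \<Rightarrow> nat \<Rightarrow> (nat \<Rightarrow> int) \<Rightarrow> 'a" where
  "outer_weight H p n m = q powi (\<Sum>j=1..p. (m j)\<^sup>2)
     * (inv_qfact q (int n - m p) * (\<Prod>j=1..<p. inv_qfact q (m (j + 1) - m j))) * H (nat (m 1))"

text \<open>The largest entry is split off. It becomes the bound v for the rest, so the linking
  factor \<open>inv_qfact q (m (Suc p) - m p)\<close> is the end factor of the shorter
  tuple.\<close>

lemma sum_outer_weight:
  assumes "p \<ge> 1"
  shows "(\<Sum>m | m \<in> outer_tuples p \<and> m p \<le> int n. outer_weight H p n m) = bailey_chain H p n"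
  using assms
proof (induction p arbitrary: n rule: nat_induct_at_least)
  case base
  have "(\<Sum>m | m \<in> outer_tuples 1 \<and> m 1 \<le> int n. outer_weight H 1 n m)
      = (\<Sum>v\<le>n. q ^ v\<^sup>2 * inv_qfact q (int n - int v) * H v)"
  proof (rule sum.reindex_bij_witness[of _ "\<lambda>v j. if j = 1 then int v else undefined" "\<lambda>m. nat (m 1)"])
    fix m assume "m \<in> {m. m \<in> outer_tuples 1 \<and> m 1 \<le> int n}"
    then have m: "m \<in> {1..1} \<rightarrow>\<^sub>E {0..}" "m 1 \<ge> 0" "m 1 \<le> int n"
      by (auto simp: outer_tuples_def)
    show "(\<lambda>j. if j = 1 then int (nat (m 1)) else undefined) = m"
      using m by (auto simp: fun_eq_iff PiE_iff extensional_def)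
    show "nat (m 1) \<in> {..n}" using m by auto
    show "q ^ (nat (m 1))\<^sup>2 * inv_qfact q (int n - int (nat (m 1))) * H (nat (m 1)) = outer_weight H 1 n m"
      using m by (simp add: outer_weight_def power_int_def nat_power_eq)
  qed (auto simp: outer_tuples_def PiE_iff extensional_def)
  then show ?case by simp
next
  case (Suc p)
  define S where "S v = {m. m \<in> outer_tuples p \<and> m p \<le> int v}" for v
  have fin: "finite (S v)" for v
    using finite_outer_tuples_last[OF Suc.hyps, of "int v"] by (simp add: S_def)
  have "(\<Sum>m | m \<in> outer_tuples (Suc p) \<and> m (Suc p) \<le> int n. outer_weight H (Suc p) n m)
    = (\<Sum>(v, m)\<in>Sigma {..n} S. q ^ v\<^sup>2 * inv_qfact q (int n - int v) * outer_weight H p v m)"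
  proof (rule sum.reindex_bij_witness[of _ "\<lambda>(v, m). m(Suc p := int v)"
        "\<lambda>m. (nat (m (Suc p)), m(Suc p := undefined))"])
    fix m assume "m \<in> {m. m \<in> outer_tuples (Suc p) \<and> m (Suc p) \<le> int n}"
    then have m: "m \<in> {1..Suc p} \<rightarrow>\<^sub>E {0..}" and mono: "\<And>j. 1 \<le> j \<Longrightarrow> j \<le> p \<Longrightarrow> m j \<le> m (Suc j)"
      and mn: "m (Suc p) \<le> int n"
      by (auto simp: outer_tuples_def)
    have pos: "m j \<ge> 0" if "1 \<le> j" "j \<le> Suc p" for j
      using m that by (auto simp: PiE_iff)
    have pp: "0 \<le> m (Suc p)" using pos by simp
    show "(case (nat (m (Suc p)), m(Suc p := undefined)) of (v, m) \<Rightarrow> m(Suc p := int v)) = m"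
      using pp by simp
    show "(nat (m (Suc p)), m(Suc p := undefined)) \<in> Sigma {..n} S"
      using mn pp m mono[of p] mono pos Suc.hyps
      by (auto simp: S_def outer_tuples_def PiE_iff extensional_def)
    have sum: "(\<Sum>j=1..Suc p. (m j)\<^sup>2) = (\<Sum>j=1..p. ((m(Suc p := undefined)) j)\<^sup>2) + (m (Suc p))\<^sup>2"
      by (simp add: sum.nat_ivl_Suc')
    have prod: "(\<Prod>j=1..<Suc p. inv_qfact q (m (j + 1) - m j)) =
      (\<Prod>j=1..<p. inv_qfact q ((m(Suc p := undefined)) (j + 1) - (m(Suc p := undefined)) j))
      * inv_qfact q (m (Suc p) - m p)"
      using Suc.hyps by (simp add: prod.op_ivl_Suc)
    have sq: "q ^ (nat (m (Suc p)))\<^sup>2 = q powi (m (Suc p))\<^sup>2"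
      using pp by (simp add: power_int_def nat_power_eq)
    have "q powi (\<Sum>j=1..Suc p. (m j)\<^sup>2) =
        q powi (\<Sum>j=1..p. ((m(Suc p := undefined)) j)\<^sup>2) * q powi (m (Suc p))\<^sup>2"
      unfolding sum by (intro power_int_add_nonneg sum_nonneg) auto
    then show "(case (nat (m (Suc p)), m(Suc p := undefined)) of (v, m) \<Rightarrow>
        q ^ v\<^sup>2 * inv_qfact q (int n - int v) * outer_weight H p v m) = outer_weight H (Suc p) n m"
      unfolding outer_weight_def prod using pp Suc.hyps by (simp add: sq mult_ac)
  next
    fix z assume "z \<in> Sigma {..n} S"
    then obtain v m where z: "z = (v, m)" "v \<le> n" "m \<in> outer_tuples p" "m p \<le> int v"
      by (auto simp: S_def)
    have undef: "m (Suc p) = undefined"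
      using z by (auto simp: outer_tuples_def PiE_iff extensional_def)
    show "(nat ((case z of (v, m) \<Rightarrow> m(Suc p := int v)) (Suc p)),
        (case z of (v, m) \<Rightarrow> m(Suc p := int v))(Suc p := undefined)) = z"
      using z undef by (auto simp: fun_eq_iff)
    show "(case z of (v, m) \<Rightarrow> m(Suc p := int v)) \<in> {m. m \<in> outer_tuples (Suc p) \<and> m (Suc p) \<le> int n}"
      using z by (auto simp: outer_tuples_def PiE_iff extensional_def less_Suc_eq)
  qed
  also have "\<dots> = (\<Sum>v\<le>n. \<Sum>m\<in>S v. q ^ v\<^sup>2 * inv_qfact q (int n - int v) * outer_weight H p v m)"
    using fin by (intro sum.Sigma[symmetric]) auto
  also have "\<dots> = bailey_chain H (Suc p) n"
    using Suc.IH by (simp add: S_def flip: sum_distrib_left)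
  finally show ?case .
qed

end

section \<open>Combining the strip identity with the Bailey chain\<close>

theorem theorem8p2:
  fixes q :: "'a::field" and n p k i :: nat
  assumes "\<forall>j\<ge>1. q ^ j \<noteq> 1"
    and "p \<ge> 1" and "k \<ge> i" and "i \<ge> 1"
  shows
    "sum_supp (outer_tuples p) (\<lambda>m.
        q powi (\<Sum>j=1..p. (m j)\<^sup>2) * qpoch q q (2 * n)
        * (inv_qfact q (int n - m p) * (\<Prod>j=1..<p. inv_qfact q (m (j + 1) - m j))
           * inv_qfact q (2 * m 1))
        * sum_supp (inner_tuples k) (\<lambda>\<nu>.
             q powi ((\<Sum>j=1..<k. (\<nu> j)\<^sup>2) + (\<Sum>j=i..<k. \<nu> j))
             * (\<Prod>j=1..<k. qbinom q
                  (2 * m 1 - 2 * (\<Sum>l=1..<j. \<nu> l) - \<nu> j - \<nu> (j + 1) - alpha i j)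
                  (\<nu> j - \<nu> (j + 1)))))
     = sum_supp (UNIV :: int set) (\<lambda>r.
          (-1) powi r
          * q powi (r * ((2 * int k + 1) * r + 2 * int k - 2 * int i + 1) div 2
                    + int p * \<lfloor>real_of_int (int i - int k - (2 * int k + 1) * r) / 2\<rfloor>\<^sup>2)
          * qbinom q (2 * int n)
              (int n - \<lfloor>real_of_int (int i - int k - (2 * int k + 1) * r) / 2\<rfloor>))"
proof -
  interpret not_root_of_unity q by unfold_locales (use assms(1) in auto)
  \<comment> \<open>Large enough for \<open>bose\<close> at every length 2m <= 2n, and for |r| > B
    to make the q-binomial on the right vanish.\<close>
  define B where "B = 2 * int n + int i + int k + 2"
  define S where "S = {-2 * B - 1..2 * B}"
  define f where "f r = (int i - int k - (2 * int k + 1) * r) div 2" for r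
  define e where "e r = r * ((2 * int k + 1) * r + 2 * int k - 2 * int i + 1) div 2" for r
  define w where "w r = (-1) powi r * q powi e r" for r
  have floor: "\<lfloor>real_of_int (int i - int k - (2 * int k + 1) * r) / 2\<rfloor> = f r" for r
    unfolding f_def using floor_divide_of_int_eq[of "int i - int k - (2 * int k + 1) * r" 2] by simp
  have e_nonneg: "e r \<ge> 0" for r
    unfolding e_def using right_exponent(2)[of "int i" "int k" r] assms by simp
  define I where "I M = sum_supp (inner_tuples k) (inner_weight k i (2 * M))" for M
  define H where "H m = inv_qfact q (2 * int m) * I (int m)" for m
  \<comment> \<open>The factor 1/(q;q)_(2m) turns the q-binomials of the strip identity into the
    products needed in \<open>bailey_chain_eq\<close>; at m = n the same equation leads
    back.\<close>
  have binom: "inv_qfact q (2 * int m) * qbinom q (2 * int m) (int m - d)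
      = inv_qfact q (int m - d) * inv_qfact q (int m + d)" for m d
    by (auto simp: inv_qfact_def qbinom_def)
  have H: "H m = (\<Sum>r\<in>S. w r * (inv_qfact q (int m - f r) * inv_qfact q (int m + f r)))" if "m \<le> n" for m
  proof -
    have "I (int m) = (\<Sum>N\<le>2 * m. ferm (k - 1) i (int (2 * m)) N)"
      unfolding I_def using inner_sum_eq_ferm[of i k "2 * m"] assms by simp
    also have "\<dots> = bose B (2 * int k + 1) (int i) (2 * m) (int k)
        + bose B (2 * int k + 1) (int i) (2 * m) (int k + 1)"
      using assms that by (intro sum_ferm_eq_bose) (auto simp: B_def)
    also have "\<dots> = (\<Sum>r\<in>S. w r * qbinom q (2 * int m) (int m - f r))"
      unfolding S_def w_def e_def f_def using assms by (intro bose_sum_eq) (auto simp: B_def)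
    finally show ?thesis
      unfolding H_def binom[symmetric] by (simp add: sum_distrib_left mult_ac)
  qed
  define T where "T = {m. m \<in> outer_tuples p \<and> m p \<le> int n}"
  have finT: "finite T"
    unfolding T_def using finite_outer_tuples_last[of p "int n"] assms by simp
  have "sum_supp (outer_tuples p) (\<lambda>m. q powi (\<Sum>j=1..p. (m j)\<^sup>2) * qpoch q q (2 * n)
        * (inv_qfact q (int n - m p) * (\<Prod>j=1..<p. inv_qfact q (m (j + 1) - m j))
           * inv_qfact q (2 * m 1)) * I (m 1))
     = (\<Sum>m\<in>T. q powi (\<Sum>j=1..p. (m j)\<^sup>2) * qpoch q q (2 * n)
        * (inv_qfact q (int n - m p) * (\<Prod>j=1..<p. inv_qfact q (m (j + 1) - m j))
           * inv_qfact q (2 * m 1)) * I (m 1))"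
    by (rule sum_supp_eq_sum[OF finT]) (auto simp: T_def inv_qfact_neg)
  also have "\<dots> = (\<Sum>m\<in>T. qpoch q q (2 * n) * outer_weight H p n m)"
  proof (intro sum.cong refl)
    fix m assume "m \<in> T"
    then have "m 1 \<ge> 0" using assms by (auto simp: T_def outer_tuples_def PiE_iff)
    then show "q powi (\<Sum>j=1..p. (m j)\<^sup>2) * qpoch q q (2 * n)
        * (inv_qfact q (int n - m p) * (\<Prod>j=1..<p. inv_qfact q (m (j + 1) - m j))
           * inv_qfact q (2 * m 1)) * I (m 1) = qpoch q q (2 * n) * outer_weight H p n m"
      by (simp add: outer_weight_def H_def mult_ac)
  qed
  also have "\<dots> = qpoch q q (2 * n) * bailey_chain H p n"
    using sum_outer_weight[of p H n] assms by (simp add: T_def flip: sum_distrib_left)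
  also have "\<dots> = (\<Sum>r\<in>S. w r * q powi (int p * (f r)\<^sup>2)
      * (qpoch q q (2 * n) * (inv_qfact q (int n - f r) * inv_qfact q (int n + f r))))"
  proof -
    have "bailey_chain H p n = (\<Sum>r\<in>S. w r * q powi (int p * (f r)\<^sup>2)
        * (inv_qfact q (int n - f r) * inv_qfact q (int n + f r)))"
      by (rule bailey_chain_eq[OF H order.refl])
    then show ?thesis by (simp add: sum_distrib_left mult_ac)
  qed
  also have "\<dots> = (\<Sum>r\<in>S. (-1) powi r * q powi (e r + int p * (f r)\<^sup>2) * qbinom q (2 * int n) (int n - f r))"
  proof (intro sum.cong refl)
    fix r
    have "qpoch q q (2 * n) * (inv_qfact q (int n - f r) * inv_qfact q (int n + f r))
        = qbinom q (2 * int n) (int n - f r)"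
      unfolding binom[symmetric] using inv_qfact_nat[of "2 * n"] by simp
    then show "w r * q powi (int p * (f r)\<^sup>2)
        * (qpoch q q (2 * n) * (inv_qfact q (int n - f r) * inv_qfact q (int n + f r)))
      = (-1) powi r * q powi (e r + int p * (f r)\<^sup>2) * qbinom q (2 * int n) (int n - f r)"
      using e_nonneg[of r] by (simp add: w_def power_int_add_nonneg mult_ac)
  qed
  also have "\<dots> = sum_supp UNIV (\<lambda>r. (-1) powi r * q powi (e r + int p * (f r)\<^sup>2)
      * qbinom q (2 * int n) (int n - f r))"
  proof (rule sum_supp_eq_sum[symmetric])
    fix r assume "r \<notin> S"
    then have r: "\<bar>r\<bar> > B" by (auto simp: S_def B_def)
    have "\<bar>r\<bar> * 1 \<le> \<bar>r\<bar> * (2 * int k + 1)" by (intro mult_left_mono) auto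
    then have "\<bar>(2 * int k + 1) * r\<bar> > B" using r by (simp add: abs_mult mult.commute)
    then have "\<bar>f r\<bar> > int n" unfolding f_def B_def by linarith
    then have "qbinom q (2 * int n) (int n - f r) = 0" by (intro qbinom_eq_0) auto
    then show "(-1) powi r * q powi (e r + int p * (f r)\<^sup>2) * qbinom q (2 * int n) (int n - f r) = 0"
      by simp
  qed (auto simp: S_def)
  finally show ?thesis
    unfolding I_def inner_weight_def[abs_def] floor e_def .
qed

end
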